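(* Let $N\ge1$. Assume $f\in C^0(\mathbb{R})\cap C^2((0,\infty))$ is nondecreasing and odd, that the restriction of $f$ to $(0,\infty)$ is convex and positive, and that the limit $q_0=\lim_{u\to0^+}q(u)$ exists in $\overline{\mathbb{R}}$. Let $p_0$ be the conjugate exponent of $q_0$, let $\overline{q_\infty}=\limsup_{u\to+\infty}q(u)$, and let $\underline{p_\infty}\in\overline{\mathbb{R}}$ be the conjugate exponent of $\overline{q_\infty}$. Let $u\in C^2(\mathbb{R}^N)$ be any stable solution (not assumed bounded, nor of constant sign) of $-\Delta u=f(u)$ in $\mathbb{R}^N$. Then $u\equiv0$ if any of the following conditions holds: 1. $1\le N\le 9$, $1<p_0$ and $1<\underline{p_\infty}$; 2. $N=10$, $1<p_0<+\infty$ and $1<\underline{p_\infty}<+\infty$; 3. $N\ge 11$, $1<p_0<p_c(N)$ and $1<\underline{p_\infty}<p_c(N)$.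
   Context: For $u>0$, $q(u)=\dfrac{f'(u)^2}{f(u)f''(u)}$ if $f(u)f''(u)\ne0$, and $q(u)=+\infty$ otherwise. The conjugate exponent $p\in\overline{\mathbb{R}}$ of $q$ is defined by $1/p+1/q=1$, i.e. $p=q/(q-1)$ if $q\notin\{1,+\infty\}$, $p=+\infty$ if $q=1$, $p=1$ if $q=+\infty$. For $N\ge 11$, $p_c(N)=\dfrac{(N-2)^2-4N+8\sqrt{N-1}}{(N-2)(N-10)}$. A solution $u\in C^2(\mathbb{R}^N)$ of $-\Delta u=f(u)$ in $\mathbb{R}^N$ is stable if for all $\varphi\in C^1_c(\mathbb{R}^N)$, $\int_{\mathbb{R}^N} f'(u)\varphi^2\,dx\le\int_{\mathbb{R}^N}|\nabla\varphi|^2\,dx$. *)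

theory Defs
  imports "HOL-Analysis.Analysis"
begin

definition C2_pos :: "(real \<Rightarrow> real) \<Rightarrow> bool" where
  "C2_pos f \<longleftrightarrow>
     (\<forall>t>0. f differentiable (at t)) \<and>
     (\<forall>t>0. deriv f differentiable (at t)) \<and>
     continuous_on {0<..} (deriv (deriv f))"

definition q_fun :: "(real \<Rightarrow> real) \<Rightarrow> real \<Rightarrow> ereal" where
  "q_fun f t =
     (if f t * deriv (deriv f) t \<noteq> 0
      then ereal ((deriv f t)\<^sup>2 / (f t * deriv (deriv f) t)) else \<infinity>)"

(* Only used at q > -\<infinity>: q_fun f is nonnegative for positive convex f. *)
definition conj_exponent :: "ereal \<Rightarrow> ereal" where
  "conj_exponent q = (if q = 1 then \<infinity> else if q = \<infinity> then 1 else q / (q - 1))"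

definition p_c :: "nat \<Rightarrow> real" where
  "p_c N = ((real N - 2)\<^sup>2 - 4 * real N + 8 * sqrt (real N - 1)) /
           ((real N - 2) * (real N - 10))"

definition grad :: "(real ^ 'n \<Rightarrow> real) \<Rightarrow> real ^ 'n \<Rightarrow> real ^ 'n" where
  "grad g x = (THE D. GDERIV g x :> D)"

lemma grad_eqI:
  assumes "GDERIV g x :> D"
  shows "grad g x = D"
  unfolding grad_def
proof (rule the_equality)
  fix D' assume "GDERIV g x :> D'"
  with assms have "(\<lambda>h. inner h D') = (\<lambda>h. inner h D)"
    unfolding gderiv_def by (blast intro: has_derivative_unique)
  then have "inner h D' = inner h D" for h by (rule fun_cong)
  then show "D' = D" using vector_eq_ldot[of D' D] by blast
qed (fact assms)

definition C1 :: "(real ^ 'n \<Rightarrow> real) \<Rightarrow> bool" where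
  "C1 g \<longleftrightarrow> (\<forall>x. g differentiable (at x)) \<and> continuous_on UNIV (grad g)"

definition C2 :: "(real ^ 'n \<Rightarrow> real) \<Rightarrow> bool" where
  "C2 g \<longleftrightarrow> C1 g \<and> (\<forall>i. C1 (\<lambda>x. grad g x $ i))"

definition laplacian :: "(real ^ 'n \<Rightarrow> real) \<Rightarrow> real ^ 'n \<Rightarrow> real" where
  "laplacian g x = (\<Sum>i\<in>UNIV. grad (\<lambda>y. grad g y $ i) x $ i)"

definition C1_compact :: "(real ^ 'n \<Rightarrow> real) \<Rightarrow> bool" where
  "C1_compact \<phi> \<longleftrightarrow> C1 \<phi> \<and> compact (closure {x. \<phi> x \<noteq> 0})"

definition is_solution :: "(real \<Rightarrow> real) \<Rightarrow> (real ^ 'n \<Rightarrow> real) \<Rightarrow> bool" where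
  "is_solution f u \<longleftrightarrow> C2 u \<and> (\<forall>x. - laplacian u x = f (u x))"

(* For f continuous, odd, and positive and convex on the positive half-line, f is
   differentiable also at 0 and its derivative is continuous on the whole line, so that
   both integrands below are continuous with compact support. *)
definition stable_solution :: "(real \<Rightarrow> real) \<Rightarrow> (real ^ 'n \<Rightarrow> real) \<Rightarrow> bool" where
  "stable_solution f u \<longleftrightarrow> is_solution f u \<and>
     (\<forall>\<phi>. C1_compact \<phi> \<longrightarrow>
        (\<integral>x. deriv f (u x) * (\<phi> x)\<^sup>2 \<partial>lborel) \<le> (\<integral>x. (norm (grad \<phi> x))\<^sup>2 \<partial>lborel))"

end

theory Submission
  imports Defs
begin

text \<open>
  Each of the three conditions implies \<open>N < 4 q\<^sub>0 + 4 \<surd>q\<^sub>0 + 2\<close>.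
  Following Farina, stability is tested with \<open>\<psi>(u)\<zeta>\<close> and the equation with \<open>\<phi>(u)\<zeta>\<^sup>2\<close>,
  where \<open>\<phi>' = \<psi>'\<^sup>2\<close>; this leaves
  \<open>\<integral> (f'\<psi>\<^sup>2 - f\<phi>)(u) \<zeta>\<^sup>2 \<le> C \<integral> \<psi>(u)\<^sup>2 (|\<nabla>\<zeta>|\<^sup>2 + |\<Delta>\<zeta>\<^sup>2|)\<close>.
  If \<open>\<psi>'/\<psi> = (1 + \<beta>) f'/f\<close>, then
  \<open>(f'\<psi>\<^sup>2/f - \<phi>)' = \<psi>\<^sup>2 (f'/f)\<^sup>2 (1/q - \<beta>\<^sup>2)\<close>. Nothing is known about \<open>q\<close> at intermediate
  values, so \<open>\<beta>\<close> is taken to vanish there; near \<open>0\<close> it is slightly below \<open>1/\<surd>q\<^sub>0\<close>, and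
  it is a small positive constant near infinity. The gain near \<open>0\<close> survives the middle range and
  gives \<open>f'\<psi>\<^sup>2 - f\<phi> \<ge> \<kappa> f'\<psi>\<^sup>2\<close> everywhere. Since moreover \<open>\<psi>\<^sup>2\<close> is bounded by powers of
  \<open>f'\<close> with exponents larger than \<open>N/2 - 1\<close>, at each point the right-hand side is either absorbed
  or of size \<open>o(R\<^sup>-\<^sup>N)\<close> for the cutoff \<open>\<zeta> = (1 - |x|\<^sup>2/R\<^sup>2)\<^sub>+\<^sup>k\<^sup>+\<^sup>1\<close>. Letting \<open>R \<rightarrow> \<infinity>\<close>
  yields \<open>f'(u)\<psi>(u)\<^sup>2 = 0\<close>.
\<close>

subsection \<open>The weight on the positive half-line\<close>

lemma antiderivative_exists:
  fixes g :: "real \<Rightarrow> real"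
  assumes "continuous_on UNIV g"
  obtains G where "G 0 = 0" "\<And>t. (G has_real_derivative g t) (at t)"
proof -
  have "isCont g x" for x
    using assms by (simp add: continuous_on_eq_continuous_at)
  then obtain F where F: "\<And>x. (F has_vector_derivative g x) (at x)"
    using einterval_antiderivative[of "-\<infinity>" \<infinity> g] by auto
  show ?thesis
  proof
    show "((\<lambda>t. F t - F 0) has_real_derivative g t) (at t)" for t
      using F[of t] by (auto intro!: derivative_eq_intros simp: has_real_derivative_iff_has_vector_derivative)
  qed simp
qed

lemma deriv_le_imp_increment_le:
  fixes F G :: "real \<Rightarrow> real"
  assumes "a \<le> b"
    and "\<And>t. a \<le> t \<Longrightarrow> t \<le> b \<Longrightarrow> (F has_real_derivative F' t) (at t)"
    and "\<And>t. a \<le> t \<Longrightarrow> t \<le> b \<Longrightarrow> (G has_real_derivative G' t) (at t)"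
    and "\<And>t. a \<le> t \<Longrightarrow> t \<le> b \<Longrightarrow> F' t \<le> G' t"
  shows "F b - F a \<le> G b - G a"
proof -
  have "(\<lambda>t. G t - F t) a \<le> (\<lambda>t. G t - F t) b"
  proof (rule DERIV_nonneg_imp_nondecreasing[OF assms(1)])
    fix t assume "a \<le> t" "t \<le> b"
    then show "\<exists>y. ((\<lambda>t. G t - F t) has_real_derivative y) (at t) \<and> 0 \<le> y"
      using assms(2-4) by (intro exI[of _ "G' t - F' t"]) (auto intro!: derivative_intros)
  qed
  then show ?thesis by simp
qed

text \<open>The increments over [t, T] are compared first and then t tends to 0; the one-sided
  limits stand in for initial values.\<close>

lemma deriv_le_imp_le_at_right_0:
  fixes F G :: "real \<Rightarrow> real"
  assumes "0 < T"
    and F: "\<And>t. 0 < t \<Longrightarrow> t \<le> T \<Longrightarrow> (F has_real_derivative F' t) (at t)"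
    and G: "\<And>t. 0 < t \<Longrightarrow> t \<le> T \<Longrightarrow> (G has_real_derivative G' t) (at t)"
    and le: "\<And>t. 0 < t \<Longrightarrow> t \<le> T \<Longrightarrow> F' t \<le> G' t"
    and F0: "(F \<longlongrightarrow> 0) (at_right 0)" and G0: "(G \<longlongrightarrow> 0) (at_right 0)"
  shows "F T \<le> G T"
proof -
  have "((\<lambda>t. F T - F t) \<longlongrightarrow> F T - 0) (at_right 0)"
       "((\<lambda>t. G T - G t) \<longlongrightarrow> G T - 0) (at_right 0)"
    by (intro tendsto_intros F0 G0)+
  moreover have "eventually (\<lambda>t. F T - F t \<le> G T - G t) (at_right 0)"
    unfolding eventually_at_right_field
  proof (intro exI[of _ T] conjI allI impI \<open>0 < T\<close>)
    fix t assume "0 < t" "t < T"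
    then show "F T - F t \<le> G T - G t"
      by (intro deriv_le_imp_increment_le[of t T F F' G G']) (auto intro: F G le)
  qed
  ultimately have "F T - 0 \<le> G T - 0"
    by (intro tendsto_le[of "at_right 0"]) auto
  then show ?thesis by simp
qed

text \<open>The open half-line is where \<open>f\<close> is assumed to be of class C2.
  \<open>f''_nonneg\<close> encodes convexity, and \<open>f_at_0\<close> is what continuity and
  oddness give at the end point.\<close>

locale convex_nonlinearity =
  fixes f f' f'' :: "real \<Rightarrow> real"
  assumes df: "0 < t \<Longrightarrow> (f has_real_derivative f' t) (at t)"
    and ddf: "0 < t \<Longrightarrow> (f' has_real_derivative f'' t) (at t)"
    and f_pos: "0 < t \<Longrightarrow> 0 < f t"
    and f'_pos: "0 < t \<Longrightarrow> 0 < f' t"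
    and f''_nonneg: "0 < t \<Longrightarrow> 0 \<le> f'' t"
    and f_at_0: "(f \<longlongrightarrow> 0) (at_right 0)"
begin

lemma f_mono: assumes "0 < s" "s \<le> t" shows "f s \<le> f t"
proof (rule DERIV_nonneg_imp_nondecreasing[OF assms(2)], intro exI conjI)
  fix x assume "s \<le> x"
  with assms show "(f has_real_derivative f' x) (at x)" "0 \<le> f' x"
    using df[of x] f'_pos[of x] by auto
qed

lemma f'_mono: assumes "0 < s" "s \<le> t" shows "f' s \<le> f' t"
proof (rule DERIV_nonneg_imp_nondecreasing[OF assms(2)], intro exI conjI)
  fix x assume "s \<le> x"
  with assms show "(f' has_real_derivative f'' x) (at x)" "0 \<le> f'' x"
    by (auto intro: ddf f''_nonneg)
qed

text \<open>\<open>f\<close> vanishes at 0 and its slope on (0, T] is at most \<open>f' T\<close>.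
  This keeps \<open>f t / t\<close> bounded near 0, as \<open>g_quotient_at_0\<close>
  requires.\<close>

lemma f_le: assumes "0 < t" "t \<le> T" shows "f t \<le> f' T * t"
proof -
  have "f t \<le> (\<lambda>t. f' T * t) t"
  proof (rule deriv_le_imp_le_at_right_0[OF assms(1), where F' = f' and G' = "\<lambda>_. f' T"])
    have "((\<lambda>t. f' T * t) \<longlongrightarrow> f' T * 0) (at_right 0)" by (intro tendsto_intros)
    then show "((*) (f' T) \<longlongrightarrow> 0) (at_right 0)" by simp
  qed (use assms in \<open>auto intro!: derivative_eq_intros df f_at_0 f'_mono\<close>)
  then show ?thesis by simp
qed

lemma continuous_f: "continuous_on {0<..} f"
  by (intro continuous_at_imp_continuous_on ballI DERIV_isCont[OF df]) auto

lemma continuous_f': "continuous_on {0<..} f'"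
  by (intro continuous_at_imp_continuous_on ballI DERIV_isCont[OF ddf]) auto

end

text \<open>The argument of \<open>\<beta>\<close> and \<open>P\<close> is \<open>ln (f t)\<close>, so that the weight
  \<open>f exp (P (ln f))\<close> has logarithmic derivative \<open>(1 + \<beta>) f'/f\<close>. The bounds \<open>\<nu>\<close>, \<open>\<theta>\<close>
  and \<open>\<mu>\<close> are bounds on \<open>1/q\<close>.\<close>

locale weighted_nonlinearity = convex_nonlinearity +
  fixes \<beta> P :: "real \<Rightarrow> real" and t0 t1 a b0 b1 \<nu> \<theta> \<mu> :: real
  assumes dP: "(P has_real_derivative \<beta> y) (at y)"
    and \<beta>_cont: "continuous_on UNIV \<beta>"
    and \<beta>_nonneg: "0 \<le> \<beta> y" 
    and \<beta>_left: "y \<le> a \<Longrightarrow> \<beta> y = b0"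
    and t01: "0 < t0" "t0 \<le> t1"
    and \<beta>_near_0: "\<lbrakk>0 < t; t \<le> t0\<rbrakk> \<Longrightarrow> \<beta> (ln (f t)) \<le> b0"
    and \<beta>_middle: "\<lbrakk>t0 \<le> t; t \<le> t1\<rbrakk> \<Longrightarrow> \<beta> (ln (f t)) = 0"
    and \<beta>_large: "t1 \<le> t \<Longrightarrow> \<beta> (ln (f t)) \<le> b1"
    and b0: "0 < b0" "b0\<^sup>2 < \<nu>" "\<nu> \<le> 1" and b1: "0 \<le> b1" "b1\<^sup>2 < \<mu>" "\<mu> \<le> 1"
    and near_0: "\<lbrakk>0 < t; t \<le> t0\<rbrakk> \<Longrightarrow> \<nu> * (f' t)\<^sup>2 \<le> f t * f'' t"
      "\<lbrakk>0 < t; t \<le> t0\<rbrakk> \<Longrightarrow> f t * f'' t \<le> \<theta> * (f' t)\<^sup>2"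
    and large: "t1 \<le> t \<Longrightarrow> \<mu> * (f' t)\<^sup>2 \<le> f t * f'' t"
begin

definition g :: "real \<Rightarrow> real" where "g t = f t * exp (P (ln (f t)))"
definition g' :: "real \<Rightarrow> real" where "g' t = (1 + \<beta> (ln (f t))) * g t * (f' t / f t)"
text \<open>Since \<open>f t * W t\<close> is \<open>f' t * (g t)\<^sup>2\<close>, bounding \<phi>
  by \<open>(1 - \<kappa>) * W\<close> is the gap between \<open>f \<phi>\<close> and
  \<open>f' \<psi>\<^sup>2\<close> after division by \<open>f\<close>.\<close>

definition W :: "real \<Rightarrow> real" where "W t = (g t)\<^sup>2 * (f' t / f t)"

lemma g_pos: "0 < t \<Longrightarrow> 0 < g t"
  by (simp add: g_def f_pos)

lemma g'_pos: "0 < t \<Longrightarrow> 0 < g' t"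
  using \<beta>_nonneg[of "ln (f t)"] by (simp add: g'_def f_pos f'_pos g_pos)

lemma W_pos: "0 < t \<Longrightarrow> 0 < W t"
  using g_pos[of t] by (simp add: W_def f_pos f'_pos)

lemma dg: assumes "0 < t" shows "(g has_real_derivative g' t) (at t)"
proof -
  note [derivative_intros] = DERIV_chain2[OF dP]
  have "(g has_real_derivative
      f' t * exp (P (ln (f t))) + exp (P (ln (f t))) * (\<beta> (ln (f t)) * (f' t / f t)) * f t) (at t)"
    unfolding g_def by (rule derivative_eq_intros df assms f_pos refl | simp add: assms f_pos)+
  moreover have "f' t * exp (P (ln (f t))) + exp (P (ln (f t))) * (\<beta> (ln (f t)) * (f' t / f t)) * f t = g' t"
    using f_pos[OF assms] by (simp add: g'_def g_def field_simps)
  ultimately show ?thesis by simp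
qed

lemma dW:
  assumes "0 < t"
  shows "(W has_real_derivative
    (g t)\<^sup>2 * (f'' t / f t + (1 + 2 * \<beta> (ln (f t))) * (f' t / f t)\<^sup>2)) (at t)"
proof -
  have "(W has_real_derivative
      2 * g t * g' t * (f' t / f t) + (f'' t * f t - f' t * f' t) / (f t * f t) * (g t)\<^sup>2) (at t)"
    unfolding W_def by (rule derivative_eq_intros df ddf dg assms refl | simp add: assms f_pos less_imp_neq[symmetric])+
  moreover have "2 * g t * g' t * (f' t / f t) + (f'' t * f t - f' t * f' t) / (f t * f t) * (g t)\<^sup>2
     = (g t)\<^sup>2 * (f'' t / f t + (1 + 2 * \<beta> (ln (f t))) * (f' t / f t)\<^sup>2)"
    using f_pos[OF assms] by (simp add: g'_def field_simps power2_eq_square)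
  ultimately show ?thesis by simp
qed

lemma W_mono: assumes "0 < s" "s \<le> t" shows "W s \<le> W t"
proof (rule DERIV_nonneg_imp_nondecreasing[OF assms(2)])
  fix x assume "s \<le> x"
  with assms have x: "0 < x" by simp
  have "0 \<le> (g x)\<^sup>2 * (f'' x / f x + (1 + 2 * \<beta> (ln (f x))) * (f' x / f x)\<^sup>2)"
    using f_pos[OF x] f''_nonneg[OF x] \<beta>_nonneg[of "ln (f x)"] by simp
  with dW[OF x] show "\<exists>y. (W has_real_derivative y) (at x) \<and> 0 \<le> y" by blast
qed

text \<open>Let b be the value of \<beta>. Bounding \<open>f'' / f\<close> below by
  \<open>l * (f' / f)\<^sup>2\<close> reduces the claim to
  \<open>(1 + b)\<^sup>2 \<le> (1 - \<kappa>) * (1 + 2 * b + l)\<close>, where for \<kappa> = 0 the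
  sides differ by at least \<open>l - c\<close>. As b and \<open>l\<close> are at most 1, the last
  factor is at most 4, which explains the 4 in the bound on \<kappa>.\<close>

lemma deriv_compare:
  assumes t: "0 < t" and l: "l * (f' t)\<^sup>2 \<le> f t * f'' t" and "(\<beta> (ln (f t)))\<^sup>2 \<le> c" "c \<le> l" "l \<le> 1"
    and \<kappa>: "0 \<le> \<kappa>" "\<kappa> \<le> (l - c) / 4"
  shows "(g' t)\<^sup>2 \<le> (1 - \<kappa>) * ((g t)\<^sup>2 * (f'' t / f t + (1 + 2 * \<beta> (ln (f t))) * (f' t / f t)\<^sup>2))"
proof -
  let ?b = "\<beta> (ln (f t))" and ?r = "f' t / f t"
  have "0 \<le> c" using assms(3) zero_le_power2 order_trans by blast
  have b: "0 \<le> ?b" "?b \<le> 1"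
    using \<beta>_nonneg assms(3-5) abs_square_le_1[of ?b] by auto
  have "l * ?r\<^sup>2 \<le> f'' t / f t"
    using l f_pos[OF t] by (simp add: field_simps power2_eq_square)
  have "(1 + ?b)\<^sup>2 \<le> (1 + 2 * ?b + l) - (l - c)"
    using assms(3) by (simp add: power2_sum)
  also have "\<dots> \<le> (1 + 2 * ?b + l) - 4 * \<kappa>" using \<kappa> by simp
  also have "\<dots> \<le> (1 + 2 * ?b + l) - \<kappa> * (1 + 2 * ?b + l)"
    using mult_left_mono[of "1 + 2 * ?b + l" 4 \<kappa>] b assms(5) \<kappa> by (simp add: algebra_simps)
  finally have 1: "(1 + ?b)\<^sup>2 \<le> (1 - \<kappa>) * (1 + 2 * ?b + l)" by (simp add: algebra_simps)
  have k1: "0 \<le> 1 - \<kappa>" using \<kappa> \<open>0 \<le> c\<close> assms(5) by simp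
  have "(g' t)\<^sup>2 = (g t)\<^sup>2 * ((1 + ?b)\<^sup>2 * ?r\<^sup>2)"
    by (simp add: g'_def power_mult_distrib power_divide)
  also have "\<dots> \<le> (g t)\<^sup>2 * (((1 - \<kappa>) * (1 + 2 * ?b + l)) * ?r\<^sup>2)"
    by (intro mult_left_mono mult_right_mono 1) auto
  also have "\<dots> = (g t)\<^sup>2 * ((1 - \<kappa>) * (l * ?r\<^sup>2 + (1 + 2 * ?b) * ?r\<^sup>2))"
    by (simp add: algebra_simps)
  also have "\<dots> \<le> (g t)\<^sup>2 * ((1 - \<kappa>) * (f'' t / f t + (1 + 2 * ?b) * ?r\<^sup>2))"
    by (intro mult_left_mono add_right_mono k1 \<open>l * ?r\<^sup>2 \<le> f'' t / f t\<close>) auto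
  finally show ?thesis by (simp add: algebra_simps)
qed

lemma ln_f_at_0: "filterlim (\<lambda>t. ln (f t)) at_bot (at_right 0)"
proof -
  have "filterlim f (at_right 0) (at_right 0)"
    unfolding filterlim_at using f_at_0 f_pos
    by (auto simp: eventually_at_right_field less_imp_neq[symmetric] intro!: exI[of _ 1])
  with ln_at_0 show ?thesis by (rule filterlim_compose)
qed

text \<open>Below \<open>a\<close> the function \<open>P\<close> is affine with slope
  \<open>b0 > 0\<close>, and \<open>ln (f t)\<close> tends to minus infinity. The vanishing of
  \<open>g\<close> at 0 beyond that of \<open>f\<close> comes from this factor.\<close>

lemma exp_P_at_0: "((\<lambda>t. exp (P (ln (f t)))) \<longlongrightarrow> 0) (at_right 0)"
proof -
  have P: "P y = P a + b0 * (y - a)" if "y \<le> a" for y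
  proof (cases "y = a")
    case False
    with that obtain z where "y < z" "z < a" "P a - P y = (a - y) * \<beta> z"
      using MVT2[of y a P \<beta>] dP by force
    then show ?thesis using \<beta>_left[of z] by (simp add: algebra_simps)
  qed simp
  have lim: "((\<lambda>y. exp (P a + b0 * (y - a))) \<longlongrightarrow> 0) at_bot"
  proof (rule filterlim_compose[OF exp_at_bot])
    show "filterlim (\<lambda>y. P a + b0 * (y - a)) at_bot at_bot"
      unfolding filterlim_at_bot
    proof
      fix Z
      show "\<forall>\<^sub>F y in at_bot. P a + b0 * (y - a) \<le> Z"
        using eventually_le_at_bot[of "a + (Z - P a) / b0"]
        by eventually_elim (use b0 in \<open>simp add: field_simps\<close>)
    qed
  qed
  have "((\<lambda>y. exp (P y)) \<longlongrightarrow> 0) at_bot"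
  proof (rule Lim_transform_eventually[OF lim])
    show "\<forall>\<^sub>F y in at_bot. exp (P a + b0 * (y - a)) = exp (P y)"
      using eventually_le_at_bot[of a] by eventually_elim (rule arg_cong[OF P[symmetric]])
  qed
  then show ?thesis by (rule filterlim_compose[OF _ ln_f_at_0])
qed

text \<open>The limits below split off a vanishing factor; the cofactor only has to be bounded on
  (0, t0].\<close>

lemma at_0_bounded_mult:
  fixes h k :: "real \<Rightarrow> real"
  assumes "(h \<longlongrightarrow> 0) (at_right 0)" "\<And>t. 0 < t \<Longrightarrow> t \<le> t0 \<Longrightarrow> \<bar>k t\<bar> \<le> B"
  shows "((\<lambda>t. k t * h t) \<longlongrightarrow> 0) (at_right 0)"
proof (rule Lim_null_comparison)
  show "((\<lambda>t. B * \<bar>h t\<bar>) \<longlongrightarrow> 0) (at_right 0)"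
    using tendsto_mult_left[OF tendsto_rabs[OF assms(1)], of B] by simp
  show "\<forall>\<^sub>F t in at_right 0. norm (k t * h t) \<le> B * \<bar>h t\<bar>"
    unfolding eventually_at_right_field using assms(2) t01(1)
    by (intro exI[of _ t0]) (auto simp: abs_mult intro!: mult_right_mono)
qed

lemma f'_bound_0: "0 < t \<Longrightarrow> t \<le> t0 \<Longrightarrow> \<bar>f' t\<bar> \<le> f' t0"
  using f'_mono[of t t0] f'_pos[of t] by simp

lemma g_at_0: "(g \<longlongrightarrow> 0) (at_right 0)"
  unfolding g_def using tendsto_mult[OF f_at_0 exp_P_at_0] by simp

text \<open>Up to sign this is the difference quotient at 0 of the even extension of
  \<open>g\<close>, which is therefore differentiable there with derivative 0.\<close>

lemma g_quotient_at_0: "((\<lambda>t. g t / t) \<longlongrightarrow> 0) (at_right 0)"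
proof -
  have "((\<lambda>t. (f t / t) * exp (P (ln (f t)))) \<longlongrightarrow> 0) (at_right 0)"
  proof (rule at_0_bounded_mult[OF exp_P_at_0])
    fix t assume t: "0 < t" "t \<le> t0"
    then show "\<bar>f t / t\<bar> \<le> f' t0" using f_le[OF t] f_pos[OF t(1)] by (simp add: field_simps)
  qed
  then show ?thesis by (simp add: g_def)
qed

lemma g'_at_0: "(g' \<longlongrightarrow> 0) (at_right 0)"
proof -
  have "((\<lambda>t. ((1 + \<beta> (ln (f t))) * f' t) * exp (P (ln (f t)))) \<longlongrightarrow> 0) (at_right 0)"
  proof (rule at_0_bounded_mult[OF exp_P_at_0])
    fix t assume t: "0 < t" "t \<le> t0"
    show "\<bar>(1 + \<beta> (ln (f t))) * f' t\<bar> \<le> (1 + b0) * f' t0"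
      unfolding abs_mult using \<beta>_near_0[OF t] \<beta>_nonneg[of "ln (f t)"] b0
      by (intro mult_mono f'_bound_0 t) auto
  qed
  moreover have "\<forall>\<^sub>F t in at_right 0. ((1 + \<beta> (ln (f t))) * f' t) * exp (P (ln (f t))) = g' t"
    unfolding eventually_at_right_field
    by (intro exI[of _ 1]) (auto simp: g'_def g_def less_imp_neq[OF f_pos, symmetric])
  ultimately show ?thesis by (rule Lim_transform_eventually)
qed

lemma W_at_0: "(W \<longlongrightarrow> 0) (at_right 0)"
proof -
  have "((\<lambda>t. f' t * (g t * exp (P (ln (f t))))) \<longlongrightarrow> 0) (at_right 0)"
    using tendsto_mult[OF g_at_0 exp_P_at_0] f'_bound_0
    by (intro at_0_bounded_mult[where k = f' and B = "f' t0"]) auto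
  moreover have "\<forall>\<^sub>F t in at_right 0. f' t * (g t * exp (P (ln (f t)))) = W t"
    unfolding eventually_at_right_field
    by (intro exI[of _ 1]) (auto simp: W_def g_def power2_eq_square less_imp_neq[OF f_pos, symmetric])
  ultimately show ?thesis by (rule Lim_transform_eventually)
qed

lemma continuous_g': "continuous_on {0<..} g'"
proof -
  have "continuous_on {0<..} (\<lambda>t. ln (f t))"
    by (intro continuous_on_ln continuous_f) (auto simp: less_imp_neq[OF f_pos, symmetric])
  then have "continuous_on {0<..} (\<lambda>t. \<beta> (ln (f t)))"
    by (intro continuous_on_compose2[OF \<beta>_cont]) auto
  moreover have "continuous_on {0<..} g"
    by (intro continuous_at_imp_continuous_on ballI DERIV_isCont[OF dg]) auto
  ultimately show ?thesis unfolding g'_def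
    by (intro continuous_intros continuous_f continuous_f')
      (auto simp: less_imp_neq[OF f_pos, symmetric])
qed

text \<open>Near 0 the strict inequality \<open>b0\<^sup>2 < \<nu>\<close> gives a relative gap
  \<open>k0\<close>. On the middle range only \<open>F' \<le> W'\<close> is available, but the
  absolute surplus gained at \<open>t0\<close> is kept. Beyond \<open>t1\<close> the strict
  inequality \<open>b1\<^sup>2 < \<mu>\<close> propagates a smaller relative gap to
  infinity.\<close>

lemma energy_gap:
  obtains \<kappa> where "0 < \<kappa>" "\<kappa> \<le> 1"
    "\<And>F t. \<lbrakk>(F \<longlongrightarrow> 0) (at_right 0); \<And>t. 0 < t \<Longrightarrow> (F has_real_derivative (g' t)\<^sup>2) (at t); 0 < t\<rbrakk>
      \<Longrightarrow> F t \<le> (1 - \<kappa>) * W t"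
proof -
  define k0 where "k0 = (\<nu> - b0\<^sup>2) / 4"
  \<comment> \<open>\<open>W\<close> may grow on the middle range, so the surplus
    \<open>k0 * W t0\<close> is only the fraction \<open>k1\<close> of its largest value
    \<open>W t1\<close> there.\<close>
  define k1 where "k1 = k0 * W t0 / W t1"
  define \<kappa> where "\<kappa> = min k1 ((\<mu> - b1\<^sup>2) / 4)"
  have t1: "0 < t1" using t01 by simp
  have W01: "0 < W t0" "W t0 \<le> W t1" using W_pos W_mono t01 by auto
  have k0: "0 < k0" using b0 by (simp add: k0_def)
  have k1: "0 < k1" "k1 \<le> k0" "k1 * W t1 = k0 * W t0"
    using k0 W01 by (auto simp: k1_def field_simps)
  have \<kappa>: "0 < \<kappa>" "\<kappa> \<le> k1" using k1 b1 by (auto simp: \<kappa>_def)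
  have \<kappa>': "\<kappa> \<le> (\<mu> - b1\<^sup>2) / 4" unfolding \<kappa>_def by (rule min.cobounded2)
  have "4 * \<kappa> \<le> \<mu> - b1\<^sup>2" using \<kappa>' by simp
  then have "\<kappa> \<le> 1" using b1 zero_le_power2[of b1] by linarith
  have gap: "F t \<le> (1 - \<kappa>) * W t"
    if F0: "(F \<longlongrightarrow> 0) (at_right 0)" and F: "\<And>t. 0 < t \<Longrightarrow> (F has_real_derivative (g' t)\<^sup>2) (at t)"
      and t: "0 < t" for F t
  proof -
    have left: "F s \<le> (1 - k0) * W s" if s: "0 < s" "s \<le> t0" for s
    proof (rule deriv_le_imp_le_at_right_0[OF s(1), where G = "\<lambda>s. (1 - k0) * W s"])
      show "((\<lambda>s. (1 - k0) * W s) \<longlongrightarrow> 0) (at_right 0)"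
        using tendsto_mult_left[OF W_at_0, of "1 - k0"] by simp
      show "(F has_real_derivative (g' x)\<^sup>2) (at x)" if "0 < x" for x using F that .
      show "((\<lambda>s. (1 - k0) * W s) has_real_derivative
        (1 - k0) * ((g x)\<^sup>2 * (f'' x / f x + (1 + 2 * \<beta> (ln (f x))) * (f' x / f x)\<^sup>2))) (at x)"
        if "0 < x" for x by (rule DERIV_cmult[OF dW[OF that]])
      show "(g' x)\<^sup>2 \<le> (1 - k0) * ((g x)\<^sup>2 * (f'' x / f x + (1 + 2 * \<beta> (ln (f x))) * (f' x / f x)\<^sup>2))"
        if "0 < x" "x \<le> s" for x
        using that s b0 \<beta>_near_0[of x] \<beta>_nonneg[of "ln (f x)"] k0 near_0(1)[of x]
        by (intro deriv_compare[where l = \<nu> and c = "b0\<^sup>2"] power_mono) (auto simp: k0_def)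
    qed (rule F0)
    have middle: "F s \<le> (1 - k1) * W s" if s: "t0 \<le> s" "s \<le> t1" for s
    proof -
      have "F s - F t0 \<le> W s - W t0"
      proof (rule deriv_le_imp_increment_le[OF s(1)])
        fix x assume x: "t0 \<le> x" "x \<le> s"
        then have "0 < x" using t01 by simp
        show "(F has_real_derivative (g' x)\<^sup>2) (at x)" using F \<open>0 < x\<close> .
        show "(W has_real_derivative 
          ((g x)\<^sup>2 * (f'' x / f x + (1 + 2 * \<beta> (ln (f x))) * (f' x / f x)\<^sup>2))) (at x)"
          by (rule dW[OF \<open>0 < x\<close>])
        \<comment> \<open>Where \<beta> = 0 the choice l = c = \<kappa> = 0 is admissible, and
          convexity alone compares the derivatives.\<close>
        have "0 * (f' x)\<^sup>2 \<le> f x * f'' x" using \<open>0 < x\<close> f_pos[of x] f''_nonneg[of x] by simp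
        from deriv_compare[OF \<open>0 < x\<close> this, of 0 0]
        show "(g' x)\<^sup>2 \<le> (g x)\<^sup>2 * (f'' x / f x + (1 + 2 * \<beta> (ln (f x))) * (f' x / f x)\<^sup>2)"
          using \<beta>_middle[of x] x s by simp
      qed
      moreover have "F t0 \<le> (1 - k0) * W t0" using left[of t0] t01 by simp
      moreover have "k1 * W s \<le> k1 * W t1"
        using W_mono[of s t1] s t01 k1 by (intro mult_left_mono) auto
      ultimately show ?thesis using k1(3) by (simp add: algebra_simps)
    qed
    have weaken: "F t \<le> (1 - \<kappa>) * W t" if "F t \<le> (1 - k) * W t" "\<kappa> \<le> k" "0 < t" for k t
    proof -
      have "(1 - k) * W t \<le> (1 - \<kappa>) * W t" using that W_pos[of t] by (intro mult_right_mono) auto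
      with that show ?thesis by simp
    qed
    consider "t \<le> t0" | "t0 \<le> t" "t \<le> t1" | "t1 \<le> t" by linarith
    then show ?thesis
    proof cases
      case 1
      then show ?thesis using left[of t] weaken[of t k0] \<kappa> k1 t by simp
    next
      case 2
      then show ?thesis using middle[of t] weaken[of t k1] \<kappa> t by simp
    next
      case 3
      have "F t - F t1 \<le> (1 - \<kappa>) * W t - (1 - \<kappa>) * W t1"
      proof (rule deriv_le_imp_increment_le[OF 3, where G = "\<lambda>s. (1 - \<kappa>) * W s"])
        fix x assume x: "t1 \<le> x"
        then have "0 < x" using t1 by simp
        show "(F has_real_derivative (g' x)\<^sup>2) (at x)" using F \<open>0 < x\<close> .
        show "((\<lambda>s. (1 - \<kappa>) * W s) has_real_derivative
          (1 - \<kappa>) * ((g x)\<^sup>2 * (f'' x / f x + (1 + 2 * \<beta> (ln (f x))) * (f' x / f x)\<^sup>2))) (at x)"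
          by (rule DERIV_cmult[OF dW[OF \<open>0 < x\<close>]])
        show "(g' x)\<^sup>2 \<le> (1 - \<kappa>) * ((g x)\<^sup>2 * (f'' x / f x + (1 + 2 * \<beta> (ln (f x))) * (f' x / f x)\<^sup>2))"
          using x b1 \<beta>_large[of x] \<beta>_nonneg[of "ln (f x)"] \<kappa> \<kappa>' large[of x] \<open>0 < x\<close>
          by (intro deriv_compare[where l = \<mu> and c = "b1\<^sup>2"] power_mono) auto
      qed
      moreover have "F t1 \<le> (1 - \<kappa>) * W t1"
        using weaken[of t1 k1] middle[of t1] \<kappa> t1 t01 by simp
      ultimately show ?thesis by simp
    qed
  qed
  from \<open>0 < \<kappa>\<close> \<open>\<kappa> \<le> 1\<close> gap show ?thesis by (rule that)
qed

text \<open>The function is the logarithm of \<open>g^2 / f'^s\<close>. Since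
  \<open>f'' / f'\<close> is \<open>(f f'' / f'^2) * (f' / f)\<close>, the sign of the derivative is
  that of \<open>2 * (1 + \<beta>) - s * (f f'' / f'^2)\<close>.\<close>

lemma growth_deriv:
  assumes "0 < t"
  shows "((\<lambda>t. 2 * ln (g t) - s * ln (f' t)) has_real_derivative
    2 * (1 + \<beta> (ln (f t))) * (f' t / f t) - s * (f'' t / f' t)) (at t)"
  using f_pos[OF assms] g_pos[OF assms] f'_pos[OF assms]
  by (auto intro!: derivative_eq_intros dg ddf assms simp: g'_def field_simps)

text \<open>Near 0 the bound \<theta> and \<beta> = \<open>b0\<close> make \<open>g^2 / f'^s\<close>
  nondecreasing for the first exponent. Near infinity the bound \<mu> and
  \<open>2 * (1 + \<beta>) \<le> 4\<close> make it nonincreasing for the second. The compact range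
  in between costs only a constant.\<close>

lemma growth_bound:
  obtains C where "0 < C"
    "\<And>t. 0 < t \<Longrightarrow> (g t)\<^sup>2 \<le> C * (f' t powr (2 * (1 + b0) / \<theta>) + f' t powr (4 / \<mu>))"
proof -
  define s0 where "s0 = 2 * (1 + b0) / \<theta>"
  define s1 where "s1 = 4 / \<mu>"
  have t1: "0 < t1" using t01 by simp
  have \<mu>: "0 < \<mu>" using b1 zero_le_power2[of b1] by linarith
  have "0 < \<theta>"
  proof -
    have "0 < \<nu>" using b0 zero_le_power2[of b0] by linarith
    then have "0 < \<nu> * (f' t0)\<^sup>2" using f'_pos[OF t01(1)] by simp
    also have "\<dots> \<le> \<theta> * (f' t0)\<^sup>2" using near_0[of t0] t01(1) by simp
    finally show ?thesis by (simp add: zero_less_mult_iff)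
  qed
  have "b1 \<le> 1" using b1 abs_square_le_1[of b1] by simp
  have s0: "0 < s0" and s1: "0 < s1" using \<open>0 < \<theta>\<close> \<mu> b0 by (auto simp: s0_def s1_def)
  \<comment> \<open>On (0, t2] the function \<beta> equals \<open>b0\<close> exactly. On (0, t0] it
    is only bounded above by \<open>b0\<close>, whereas the monotonicity needs a lower
    bound.\<close>
  obtain t2 where t2: "0 < t2" "t2 \<le> t0" "\<And>t. 0 < t \<Longrightarrow> t \<le> t2 \<Longrightarrow> ln (f t) \<le> a"
  proof -
    have "\<forall>\<^sub>F t in at_right 0. ln (f t) \<le> a"
      using ln_f_at_0 unfolding filterlim_at_bot by blast
    then obtain t where "0 < t" "\<And>s. 0 < s \<Longrightarrow> s < t \<Longrightarrow> ln (f s) \<le> a"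
      by (auto simp: eventually_at_right_field)
    then show ?thesis using t01 by (intro that[of "min t0 (t / 2)"]) auto
  qed
  define E where "E s t = exp (2 * ln (g t) - s * ln (f' t))" for s t
  have E: "(g t)\<^sup>2 = E s t * f' t powr s" if "0 < t" for s t
  proof -
    have "(g t)\<^sup>2 = exp (2 * ln (g t))"
      using g_pos[OF that] by (simp add: exp_double)
    also have "\<dots> = E s t * f' t powr s"
      using f'_pos[OF that] by (simp add: E_def powr_def flip: exp_add)
    finally show ?thesis .
  qed
  have f''_over: "f'' t / f' t = (f t * f'' t / (f' t)\<^sup>2) * (f' t / f t)" if "0 < t" for t
    using f_pos[OF that] f'_pos[OF that] by (simp add: field_simps power2_eq_square)
  have left: "E s0 t \<le> E s0 t2" if t: "0 < t" "t \<le> t2" for t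
  proof -
    have "2 * ln (g t) - s0 * ln (f' t) \<le> 2 * ln (g t2) - s0 * ln (f' t2)"
    proof (rule DERIV_nonneg_imp_nondecreasing[OF t(2)], intro exI conjI)
      fix x assume x: "t \<le> x" "x \<le> t2"
      then have "0 < x" "x \<le> t0" using t t2 by auto
      show "((\<lambda>t. 2 * ln (g t) - s0 * ln (f' t)) has_real_derivative
        2 * (1 + \<beta> (ln (f x))) * (f' x / f x) - s0 * (f'' x / f' x)) (at x)"
        by (rule growth_deriv[OF \<open>0 < x\<close>])
      have "f x * f'' x / (f' x)\<^sup>2 \<le> \<theta>"
        using near_0(2)[of x] f'_pos[OF \<open>0 < x\<close>] \<open>0 < x\<close> \<open>x \<le> t0\<close> by (simp add: field_simps)
      then have "s0 * (f x * f'' x / (f' x)\<^sup>2) \<le> s0 * \<theta>"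
        using s0 by (intro mult_left_mono) auto
      also have "\<dots> = 2 * (1 + b0)" using \<open>0 < \<theta>\<close> by (simp add: s0_def)
      finally have "s0 * (f x * f'' x / (f' x)\<^sup>2) * (f' x / f x) \<le> 2 * (1 + b0) * (f' x / f x)"
        using f_pos[OF \<open>0 < x\<close>] f'_pos[OF \<open>0 < x\<close>] by (intro mult_right_mono) auto
      then have "s0 * (f'' x / f' x) \<le> 2 * (1 + b0) * (f' x / f x)"
        by (simp only: f''_over[OF \<open>0 < x\<close>] mult.assoc)
      then show "0 \<le> 2 * (1 + \<beta> (ln (f x))) * (f' x / f x) - s0 * (f'' x / f' x)"
        by (simp only: \<beta>_left[OF t2(3)[OF \<open>0 < x\<close> x(2)]] diff_ge_0_iff_ge)
    qed
    then show ?thesis by (simp add: E_def)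
  qed
  have right: "E s1 t \<le> E s1 t1" if t: "t1 \<le> t" for t
  proof -
    have "2 * ln (g t) - s1 * ln (f' t) \<le> 2 * ln (g t1) - s1 * ln (f' t1)"
    proof (rule DERIV_nonpos_imp_nonincreasing[OF t], intro exI conjI)
      fix x assume x: "t1 \<le> x"
      then have "0 < x" using t1 by simp
      show "((\<lambda>t. 2 * ln (g t) - s1 * ln (f' t)) has_real_derivative
        2 * (1 + \<beta> (ln (f x))) * (f' x / f x) - s1 * (f'' x / f' x)) (at x)"
        by (rule growth_deriv[OF \<open>0 < x\<close>])
      have "\<mu> \<le> f x * f'' x / (f' x)\<^sup>2"
        using large[of x] f'_pos[OF \<open>0 < x\<close>] x by (simp add: field_simps)
      then have "s1 * \<mu> \<le> s1 * (f x * f'' x / (f' x)\<^sup>2)"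
        using s1 by (intro mult_left_mono) auto
      moreover have "s1 * \<mu> = 4" using \<mu> by (simp add: s1_def)
      moreover have "2 * (1 + \<beta> (ln (f x))) \<le> 4" using \<beta>_large[OF x] \<open>b1 \<le> 1\<close> by simp
      ultimately have "2 * (1 + \<beta> (ln (f x))) \<le> s1 * (f x * f'' x / (f' x)\<^sup>2)" by linarith
      then have "2 * (1 + \<beta> (ln (f x))) * (f' x / f x) \<le> s1 * (f x * f'' x / (f' x)\<^sup>2) * (f' x / f x)"
        using f_pos[OF \<open>0 < x\<close>] f'_pos[OF \<open>0 < x\<close>] by (intro mult_right_mono) auto
      then have "2 * (1 + \<beta> (ln (f x))) * (f' x / f x) \<le> s1 * (f'' x / f' x)"
        by (simp only: f''_over[OF \<open>0 < x\<close>] mult.assoc)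
      then show "2 * (1 + \<beta> (ln (f x))) * (f' x / f x) - s1 * (f'' x / f' x) \<le> 0"
        by (simp only: diff_le_0_iff_le)
    qed
    then show ?thesis by (simp add: E_def)
  qed
  \<comment> \<open>On [t2, t1] both \<open>g\<close> and \<open>f'\<close> are nondecreasing: the
    right end bounds \<open>g\<close> from above, the left end bounds \<open>f'\<close> from
    below.\<close>
  define M where "M = (g t1)\<^sup>2 / f' t2 powr s0"
  have middle: "(g t)\<^sup>2 \<le> M * f' t powr s0" if t: "t2 \<le> t" "t \<le> t1" for t
  proof -
    have "0 < t" using t t2 by simp
    have "g t \<le> g t1"
    proof (rule DERIV_nonneg_imp_nondecreasing[OF t(2)], intro exI conjI)
      fix x assume "t \<le> x"
      then show "(g has_real_derivative g' x) (at x)" "0 \<le> g' x"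
        using dg[of x] g'_pos[of x] \<open>0 < t\<close> by auto
    qed
    then have "(g t)\<^sup>2 \<le> (g t1)\<^sup>2" using g_pos[OF \<open>0 < t\<close>] by (intro power_mono) auto
    also have "\<dots> = M * f' t2 powr s0" using f'_pos[OF t2(1)] by (simp add: M_def)
    also have "\<dots> \<le> M * f' t powr s0"
      using f'_mono[OF t2(1) t(1)] f'_pos[OF t2(1)] s0
      by (intro mult_left_mono powr_mono2) (auto simp: M_def)
    finally show ?thesis .
  qed
  define C where "C = E s0 t2 + E s1 t1 + M"
  have C: "E s0 t2 \<le> C" "E s1 t1 \<le> C" "M \<le> C" "0 < C"
    by (auto simp: C_def M_def E_def intro!: add_nonneg_nonneg add_pos_nonneg)
  show ?thesis
  proof (rule that[OF C(4)])
    fix t :: real assume t: "0 < t"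
    have absorb: "x \<le> C * (y + z)" if "x \<le> c * y" "c \<le> C" "0 \<le> y" "0 \<le> z" for x y z c :: real
    proof -
      have "c * y \<le> C * y" using that by (intro mult_right_mono)
      moreover have "0 \<le> C * z" using C(4) that by simp
      ultimately show ?thesis using that(1) by (simp add: distrib_left)
    qed
    have absorb': "x \<le> C * (z + y)" if "x \<le> c * y" "c \<le> C" "0 \<le> y" "0 \<le> z" for x y z c :: real
      using absorb[OF that] by (simp add: add.commute)
    consider "t \<le> t2" | "t2 \<le> t" "t \<le> t1" | "t1 \<le> t" by linarith
    then have "(g t)\<^sup>2 \<le> C * (f' t powr s0 + f' t powr s1)"
    proof cases
      case 1
      show ?thesis using left[OF t 1] E[OF t, of s0]
        by (intro absorb[OF _ C(1)]) (auto intro: mult_right_mono)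
    next
      case 2
      show ?thesis using middle[OF 2] by (intro absorb[OF _ C(3)]) auto
    next
      case 3
      show ?thesis using right[OF 3] E[OF t, of s1]
        by (intro absorb'[OF _ C(2)]) (auto intro: mult_right_mono)
    qed
    then show "(g t)\<^sup>2 \<le> C * (f' t powr (2 * (1 + b0) / \<theta>) + f' t powr (4 / \<mu>))"
      by (simp add: s0_def s1_def)
  qed
qed

end


subsection \<open>Even extension of the weight, and the exponents\<close>

lemma tendsto_even_at_0:
  fixes h :: "real \<Rightarrow> real"
  assumes "(h \<longlongrightarrow> 0) (at_right 0)"
  shows "((\<lambda>t. h \<bar>t\<bar>) \<longlongrightarrow> 0) (at 0)"
proof (rule filterlim_compose[OF assms])
  show "filterlim abs (at_right 0) (at (0::real))"
    unfolding filterlim_at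
  proof
    show "(abs \<longlongrightarrow> 0) (at (0::real))" using tendsto_rabs[OF tendsto_ident_at, of "0::real" UNIV] by simp
    show "\<forall>\<^sub>F t in at (0::real). \<bar>t\<bar> \<in> {0<..} \<and> \<bar>t\<bar> \<noteq> 0"
      by (auto simp: eventually_at intro: exI[of _ 1])
  qed
qed

text \<open>The solution may change sign, so the weight has to be C1 across 0. Both the difference
  quotient and the derivative tend to 0 there, so the reflected halves fit together.\<close>

lemma even_extension:
  fixes g g' :: "real \<Rightarrow> real"
  defines "\<psi> \<equiv> \<lambda>t. if t = 0 then 0 else g \<bar>t\<bar>"
    and "\<psi>' \<equiv> \<lambda>t. if t = 0 then 0 else sgn t * g' \<bar>t\<bar>"
  assumes dg: "\<And>t. 0 < t \<Longrightarrow> (g has_real_derivative g' t) (at t)"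
    and g': "continuous_on {0<..} g'"
    and g_0: "((\<lambda>t. g t / t) \<longlongrightarrow> 0) (at_right 0)" and g'_0: "(g' \<longlongrightarrow> 0) (at_right 0)"
  shows "(\<psi> has_real_derivative \<psi>' t) (at t)" and "continuous_on UNIV \<psi>'"
proof -
  consider "0 < t" | "t < 0" | "t = 0" by linarith
  then show "(\<psi> has_real_derivative \<psi>' t) (at t)"
  proof cases
    case 1
    show ?thesis
      by (rule has_field_derivative_transform_within_open[of g _ t "{0<..}"])
        (use 1 dg[OF 1] in \<open>auto simp: \<psi>_def \<psi>'_def\<close>)
  next
    case 2
    have "((\<lambda>t. g (- t)) has_real_derivative - g' (- t)) (at t)"
      using DERIV_chain2[OF dg[of "- t"] DERIV_minus[OF DERIV_ident]] 2 by simp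
    with 2 show ?thesis
      by (auto simp: \<psi>_def \<psi>'_def
          intro: has_field_derivative_transform_within_open[of "\<lambda>t. g (- t)" _ t "{..<0}"])
  next
    case 3
    have "((\<lambda>y. (\<psi> y - \<psi> 0) / (y - 0)) \<longlongrightarrow> 0) (at 0)"
    proof (rule Lim_null_comparison[OF _ tendsto_rabs_zero[OF tendsto_even_at_0[OF g_0]]])
      show "\<forall>\<^sub>F y in at 0. norm ((\<psi> y - \<psi> 0) / (y - 0)) \<le> \<bar>g \<bar>y\<bar> / \<bar>y\<bar>\<bar>"
        by (intro always_eventually) (auto simp: \<psi>_def)
    qed
    with 3 show ?thesis by (simp add: has_field_derivative_iff \<psi>'_def)
  qed
  have "isCont \<psi>' t" for t
  proof -
    consider "0 < t" | "t < 0" | "t = 0" by linarith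
    then show "isCont \<psi>' t"
    proof cases
      case 1
      have "continuous_on {0<..} \<psi>' \<longleftrightarrow> continuous_on {0<..} g'"
        by (intro continuous_on_cong) (auto simp: \<psi>'_def)
      with g' 1 show ?thesis by (simp add: continuous_on_eq_continuous_at)
    next
      case 2
      have "continuous_on {..<0} (\<lambda>t. - g' (- t))"
        by (intro continuous_intros continuous_on_compose2[OF g']) auto
      also have "?this \<longleftrightarrow> continuous_on {..<0} \<psi>'"
        by (intro continuous_on_cong) (auto simp: \<psi>'_def)
      finally show ?thesis using 2 by (simp add: continuous_on_eq_continuous_at)
    next
      case 3
      have "(\<psi>' \<longlongrightarrow> 0) (at 0)"
      proof (rule Lim_null_comparison[OF _ tendsto_rabs_zero[OF tendsto_even_at_0[OF g'_0]]])
        show "\<forall>\<^sub>F y in at 0. norm (\<psi>' y) \<le> \<bar>g' \<bar>y\<bar>\<bar>"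
          by (intro always_eventually) (auto simp: \<psi>'_def abs_mult abs_sgn_eq)
      qed
      with 3 show ?thesis by (simp add: isCont_def \<psi>'_def)
    qed
  qed
  then show "continuous_on UNIV \<psi>'" by (simp add: continuous_at_imp_continuous_on)
qed

lemma odd_antiderivative:
  fixes h :: "real \<Rightarrow> real"
  assumes "\<And>t. (H has_real_derivative h t) (at t)" "H 0 = 0" "\<And>t. h (- t) = h t"
  shows "H (- t) = - H t"
proof -
  have "((\<lambda>t. H (- t) + H t) has_real_derivative 0) (at t)" for t
    by (auto intro!: derivative_eq_intros DERIV_chain2[of H] assms(1) simp: assms(3))
  then have "H (- t) + H t = H (- 0) + H 0" by (intro DERIV_isconst_all) blast
  then show ?thesis using assms(2) by simp
qed

lemma even_antiderivative:
  fixes h :: "real \<Rightarrow> real"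
  assumes "\<And>t. (H has_real_derivative h t) (at t)" "\<And>t. h (- t) = - h t"
  shows "H (- t) = H t"
proof -
  have "((\<lambda>t. H (- t) - H t) has_real_derivative 0) (at t)" for t
    by (auto intro!: derivative_eq_intros DERIV_chain2[of H] assms(1) simp: assms(2))
  then have "H (- t) - H t = H (- 0) - H 0" by (intro DERIV_isconst_all) blast
  then show ?thesis by simp
qed

text \<open>Collects all that the integral estimate needs: \<psi> is the even extension of
  \<open>g\<close>, and \<phi> and \<Phi> are successive antiderivatives starting from
  \<open>\<psi>'^2\<close> and vanishing at 0. This normalization makes \<phi> odd and lets its
  comparison with \<open>W\<close> start at 0.\<close>

lemma (in convex_nonlinearity) even_weight_exists:
  assumes t01: "0 < t0" "t0 \<le> t1"
    and b0: "0 < b0" "b0\<^sup>2 < \<nu>" "\<nu> \<le> 1" and b1: "0 \<le> b1" "b1\<^sup>2 < \<mu>" "\<mu> \<le> 1"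
    and near_0: "\<And>t. \<lbrakk>0 < t; t \<le> t0\<rbrakk> \<Longrightarrow> \<nu> * (f' t)\<^sup>2 \<le> f t * f'' t"
      "\<And>t. \<lbrakk>0 < t; t \<le> t0\<rbrakk> \<Longrightarrow> f t * f'' t \<le> \<theta> * (f' t)\<^sup>2"
    and large: "\<And>t. t1 \<le> t \<Longrightarrow> \<mu> * (f' t)\<^sup>2 \<le> f t * f'' t"
  obtains \<psi> \<psi>' \<phi> \<Phi> :: "real \<Rightarrow> real" and \<kappa> C :: real
  where "\<And>t. (\<psi> has_real_derivative \<psi>' t) (at t)" and "continuous_on UNIV \<psi>'"
    and "\<And>t. (\<phi> has_real_derivative (\<psi>' t)\<^sup>2) (at t)"
    and "\<And>t. (\<Phi> has_real_derivative \<phi> t) (at t)"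
    and "\<And>t. \<psi> (- t) = \<psi> t" and "\<And>t. \<phi> (- t) = - \<phi> t" and "\<psi> 0 = 0"
    and "\<And>t. 0 < t \<Longrightarrow> 0 < \<psi> t"
    and "\<And>t. 0 \<le> \<Phi> t" and "\<And>t. \<Phi> t \<le> (\<psi> t)\<^sup>2 / 2"
    and "0 < \<kappa>" and "\<And>t. 0 < t \<Longrightarrow> f t * \<phi> t \<le> (1 - \<kappa>) * (f' t * (\<psi> t)\<^sup>2)"
    and "0 < C" and "\<And>t. 0 < t \<Longrightarrow> (\<psi> t)\<^sup>2 \<le> C * (f' t powr (2 * (1 + b0) / \<theta>) + f' t powr (4 / \<mu>))"
    and "((\<lambda>t. f' t * (\<psi> t)\<^sup>2) \<longlongrightarrow> 0) (at_right 0)"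
proof -
  define a where "a = ln (f t0) - 1"
  define b where "b = ln (f t1)"
  \<comment> \<open>Piecewise linear in \<open>y\<close>: equal to \<open>b0\<close> up to
    \<open>a\<close>, descending to 0 at \<open>1 + a = ln (f t0)\<close>, zero up to
    \<open>b\<close>, then rising to \<open>b1\<close> at \<open>b + 1\<close>. The shift by 1 in
    \<open>a\<close> makes the descent end exactly at \<open>t0\<close>.\<close>
  define \<beta> where "\<beta> y = b0 * max 0 (min 1 (1 + a - y)) + b1 * (1 - max 0 (min 1 (1 + b - y)))" for y :: real
  have \<beta>_cont: "continuous_on UNIV \<beta>" unfolding \<beta>_def by (intro continuous_intros)
  then obtain P where dP: "\<And>y. (P has_real_derivative \<beta> y) (at y)"
    using antiderivative_exists by blast
  have ln_mono: "ln (f s) \<le> ln (f t)" if "0 < s" "s \<le> t" for s t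
    using f_mono[OF that] f_pos[of s] that by simp
  have ab: "1 + a \<le> b" using ln_mono[OF t01] by (simp add: a_def b_def)
  interpret weighted_nonlinearity f f' f'' \<beta> P t0 t1 a b0 b1 \<nu> \<theta> \<mu>
  proof
    show "0 \<le> \<beta> y" for y using b0 b1 by (auto simp: \<beta>_def intro!: add_nonneg_nonneg mult_nonneg_nonneg)
    show "\<beta> y = b0" if "y \<le> a" for y using that ab by (simp add: \<beta>_def)
    show "\<beta> (ln (f t)) \<le> b0" if "0 < t" "t \<le> t0" for t
    proof -
      have "ln (f t) \<le> 1 + a" using ln_mono[OF that] by (simp add: a_def)
      with ab have "\<beta> (ln (f t)) = b0 * max 0 (min 1 (1 + a - ln (f t)))" by (simp add: \<beta>_def)
      also have "\<dots> \<le> b0 * 1" using b0 by (intro mult_left_mono) auto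
      finally show ?thesis by simp
    qed
    show "\<beta> (ln (f t)) = 0" if "t0 \<le> t" "t \<le> t1" for t
      using ln_mono[of t0 t] ln_mono[of t t1] that t01 by (simp add: \<beta>_def a_def b_def)
    show "\<beta> (ln (f t)) \<le> b1" if "t1 \<le> t" for t
    proof -
      have "b \<le> ln (f t)" using ln_mono[of t1 t] that t01 by (simp add: b_def)
      with ab have "\<beta> (ln (f t)) = b1 * (1 - max 0 (min 1 (1 + b - ln (f t))))" by (simp add: \<beta>_def)
      also have "\<dots> \<le> b1 * 1" using b1 by (intro mult_left_mono) auto
      finally show ?thesis by simp
    qed
  qed (use assms dP \<beta>_cont in auto)
  define \<psi> where "\<psi> t = (if t = 0 then 0 else g \<bar>t\<bar>)" for t
  define \<psi>' where "\<psi>' t = (if t = 0 then 0 else sgn t * g' \<bar>t\<bar>)" for t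
  have \<psi>: "(\<psi> has_real_derivative \<psi>' t) (at t)" "continuous_on UNIV \<psi>'" for t
    using even_extension[OF dg continuous_g' g_quotient_at_0 g'_at_0] unfolding \<psi>_def \<psi>'_def by auto
  have \<psi>_pos: "0 < \<psi> t" if "0 < t" for t using that g_pos by (simp add: \<psi>_def)
  have "continuous_on UNIV (\<lambda>t. (\<psi>' t)\<^sup>2)" by (intro continuous_intros \<psi>)
  then obtain \<phi> where \<phi>: "\<phi> 0 = 0" "\<And>t. (\<phi> has_real_derivative (\<psi>' t)\<^sup>2) (at t)"
    using antiderivative_exists by blast
  have "continuous_on UNIV \<phi>"
    by (intro continuous_at_imp_continuous_on ballI DERIV_isCont[OF \<phi>(2)])
  then obtain \<Phi> where \<Phi>: "\<Phi> 0 = 0" "\<And>t. (\<Phi> has_real_derivative \<phi> t) (at t)"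
    using antiderivative_exists by blast
  have \<phi>_odd: "\<phi> (- t) = - \<phi> t" for t
    by (rule odd_antiderivative[OF \<phi>(2,1)]) (simp add: \<psi>'_def)
  have \<Phi>_even: "\<Phi> (- t) = \<Phi> t" for t
    by (rule even_antiderivative[OF \<Phi>(2) \<phi>_odd])
  have "isCont \<phi> 0" using DERIV_isCont[OF \<phi>(2)] .
  then have \<phi>_0: "(\<phi> \<longlongrightarrow> 0) (at_right 0)"
    using \<phi>(1) by (auto simp: isCont_def filterlim_at_split)
  obtain \<kappa> where \<kappa>: "0 < \<kappa>" "\<kappa> \<le> 1"
    and gap: "\<And>F t. \<lbrakk>(F \<longlongrightarrow> 0) (at_right 0); \<And>t. 0 < t \<Longrightarrow> (F has_real_derivative (g' t)\<^sup>2) (at t); 0 < t\<rbrakk>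
      \<Longrightarrow> F t \<le> (1 - \<kappa>) * W t"
    using energy_gap by blast
  have \<phi>_le: "\<phi> t \<le> (1 - \<kappa>) * W t" if "0 < t" for t
  proof (rule gap[OF \<phi>_0 _ that])
    show "(\<phi> has_real_derivative (g' t)\<^sup>2) (at t)" if "0 < t" for t
      using \<phi>(2)[of t] that by (simp add: \<psi>'_def)
  qed
  have \<phi>_nonneg: "0 \<le> \<phi> t" if "0 \<le> t" for t
    using deriv_le_imp_increment_le[OF that, of "\<lambda>_. 0" "\<lambda>_. 0" \<phi> "\<lambda>t. (\<psi>' t)\<^sup>2"] \<phi> by simp
  \<comment> \<open>For positive arguments \<phi> \<le> W \<le> (1 + \<beta>) W = \<psi> \<psi>',
    the derivative of \<open>\<psi>\<^sup>2 / 2\<close>. Thus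
    \<open>\<psi>\<^sup>2 / 2 - \<Phi>\<close>, later the coefficient of a Laplacian, lies between 0
    and \<open>\<psi>\<^sup>2 / 2\<close>.\<close>
  have \<Phi>: "0 \<le> \<Phi> t \<and> \<Phi> t \<le> (\<psi> t)\<^sup>2 / 2" if t: "0 \<le> t" for t
  proof
    show "0 \<le> \<Phi> t"
      using deriv_le_imp_increment_le[OF that, of "\<lambda>_. 0" "\<lambda>_. 0" \<Phi> \<phi>] \<Phi> \<phi>_nonneg by simp
    have "\<Phi> t - \<Phi> 0 \<le> (\<psi> t)\<^sup>2 / 2 - (\<psi> 0)\<^sup>2 / 2"
    proof (rule deriv_le_imp_increment_le[OF t \<Phi>(2)])
      fix s :: real assume "0 \<le> s"
      show "((\<lambda>t. (\<psi> t)\<^sup>2 / 2) has_real_derivative \<psi> s * \<psi>' s) (at s)"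
        by (auto intro!: derivative_eq_intros \<psi>)
      show "\<phi> s \<le> \<psi> s * \<psi>' s"
      proof (cases "s = 0")
        case False
        with \<open>0 \<le> s\<close> have s: "0 < s" by simp
        have "\<phi> s \<le> (1 - \<kappa>) * W s" using \<phi>_le[OF s] .
        also have "\<dots> \<le> 1 * W s" using \<kappa> W_pos[OF s] by (intro mult_right_mono) auto
        also have "\<dots> \<le> (1 + \<beta> (ln (f s))) * W s"
          using \<beta>_nonneg[of "ln (f s)"] W_pos[OF s] by (intro mult_right_mono) auto
        also have "\<dots> = \<psi> s * \<psi>' s"
          using s by (simp add: W_def \<psi>_def \<psi>'_def g'_def power2_eq_square)
        finally show ?thesis .
      qed (simp add: \<phi> \<psi>_def)
    qed
    then show "\<Phi> t \<le> (\<psi> t)\<^sup>2 / 2" using \<Phi>(1) by (simp add: \<psi>_def)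
  qed
  have \<psi>_even: "\<psi> (- t) = \<psi> t" for t by (simp add: \<psi>_def)
  have \<Phi>_bounds: "0 \<le> \<Phi> t" "\<Phi> t \<le> (\<psi> t)\<^sup>2 / 2" for t
    using \<Phi>[of t] \<Phi>[of "- t"] \<Phi>_even[of t] \<psi>_even[of t] by (cases "0 \<le> t"; simp)+
  obtain C where C: "0 < C"
    "\<And>t. 0 < t \<Longrightarrow> (g t)\<^sup>2 \<le> C * (f' t powr (2 * (1 + b0) / \<theta>) + f' t powr (4 / \<mu>))"
    using growth_bound by blast
  show ?thesis
  proof (rule that[OF \<psi> \<phi>(2) \<open>\<And>t. (\<Phi> has_real_derivative \<phi> t) (at t)\<close> \<psi>_even \<phi>_odd _ \<psi>_pos \<Phi>_bounds \<kappa>(1) _ C(1)])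
    show "\<psi> 0 = 0" by (simp add: \<psi>_def)
    show "f t * \<phi> t \<le> (1 - \<kappa>) * (f' t * (\<psi> t)\<^sup>2)" if "0 < t" for t
    proof -
      have "f t * \<phi> t \<le> f t * ((1 - \<kappa>) * W t)"
        using \<phi>_le[OF that] f_pos[OF that] by (intro mult_left_mono) auto
      also have "\<dots> = (1 - \<kappa>) * (f' t * (\<psi> t)\<^sup>2)"
        using f_pos[OF that] that by (simp add: W_def \<psi>_def)
      finally show ?thesis .
    qed
    show "(\<psi> t)\<^sup>2 \<le> C * (f' t powr (2 * (1 + b0) / \<theta>) + f' t powr (4 / \<mu>))" if "0 < t" for t
      using C(2)[OF that] that by (simp add: \<psi>_def)
    have "((\<lambda>t. f' t * (g t)\<^sup>2) \<longlongrightarrow> 0) (at_right 0)"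
      using tendsto_power[OF g_at_0, of 2] f'_bound_0 by (intro at_0_bounded_mult[where k = f']) auto
    then show "((\<lambda>t. f' t * (\<psi> t)\<^sup>2) \<longlongrightarrow> 0) (at_right 0)"
      by (rule Lim_transform_eventually) (auto simp: \<psi>_def eventually_at_right_field intro!: exI[of _ 1])
  qed
qed

section \<open>Choice of the exponents and the dimension bound\<close>

text \<open>With \<open>r = 1 / sqrt q\<close>, the limiting choice \<open>b0 = r\<close>,
  \<open>\<theta> = r\<^sup>2\<close> turns the last inequality into the hypothesis. Being strict,
  it survives the perturbation to \<open>r - \<epsilon>\<close> and
  \<open>(r + \<epsilon>)\<^sup>2\<close>; \<nu> is the midpoint between \<open>b0\<^sup>2\<close>
  and \<open>1 / q\<close>.\<close>

lemma weight_parameters_exist: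
  fixes q n :: real
  assumes "1 \<le> q" "n < 4 * q + 4 * sqrt q + 2"
  obtains b0 \<nu> \<theta> where "0 < b0" "b0\<^sup>2 < \<nu>" "\<nu> < 1 / q" "1 / q < \<theta>" "n < 2 + 4 * (1 + b0) / \<theta>"
proof -
  define r where "r = 1 / sqrt q"
  have r: "0 < r" "r\<^sup>2 = 1 / q" using assms by (auto simp: r_def power_divide)
  have "4 * (1 + r) / r\<^sup>2 = 4 * q + 4 * sqrt q"
    using assms by (simp add: r_def power_divide field_simps real_div_sqrt)
  with assms(2) have n: "n < 2 + 4 * (1 + (r - 0)) / (r + 0)\<^sup>2" by simp
  have "((\<lambda>\<epsilon>. 2 + 4 * (1 + (r - \<epsilon>)) / (r + \<epsilon>)\<^sup>2) \<longlongrightarrow> 2 + 4 * (1 + (r - 0)) / (r + 0)\<^sup>2) (at_right 0)"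
    using r by (intro tendsto_intros) auto
  from order_tendstoD(1)[OF this n]
  have "\<forall>\<^sub>F \<epsilon> in at_right 0. n < 2 + 4 * (1 + (r - \<epsilon>)) / (r + \<epsilon>)\<^sup>2" .
  moreover have "\<forall>\<^sub>F \<epsilon> in at_right 0. 0 < \<epsilon> \<and> \<epsilon> < r"
    using r(1) by (auto simp: eventually_at_right_field)
  ultimately have "\<forall>\<^sub>F \<epsilon> in at_right 0. n < 2 + 4 * (1 + (r - \<epsilon>)) / (r + \<epsilon>)\<^sup>2 \<and> 0 < \<epsilon> \<and> \<epsilon> < r"
    by eventually_elim blast
  then obtain \<epsilon> where \<epsilon>: "n < 2 + 4 * (1 + (r - \<epsilon>)) / (r + \<epsilon>)\<^sup>2" "0 < \<epsilon>" "\<epsilon> < r"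
    using eventually_happens[of _ "at_right (0::real)"] trivial_limit_at_right_real by blast
  have "(r - \<epsilon>)\<^sup>2 < r\<^sup>2" "r\<^sup>2 < (r + \<epsilon>)\<^sup>2"
    using \<epsilon> by (auto intro!: power_strict_mono)
  with \<epsilon> r show ?thesis
    by (intro that[of "r - \<epsilon>" "((r - \<epsilon>)\<^sup>2 + r\<^sup>2) / 2" "(r + \<epsilon>)\<^sup>2"]) auto
qed

text \<open>For finite q other than 1 the exponent is 1 + 1/(q - 1), which exceeds 1 only if q > 1;
  q = 1 gives infinity, and q = infinity gives 1.\<close>

lemma conj_exponent_gt_1D:
  assumes "1 < conj_exponent q"
  obtains r where "q = ereal r" "1 \<le> r"
proof (cases q)
  case (real r)
  have "\<not> r < 1"
  proof
    assume "r < 1"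
    then have "r / (r - 1) < 1" by (simp add: field_simps)
    with assms real \<open>r < 1\<close> show False by (simp add: conj_exponent_def one_ereal_def)
  qed
  with real show ?thesis by (intro that) auto
next
  case MInf
  \<comment> \<open>In extended real division the inverse of minus infinity is 0, so the quotient is
    0.\<close>
  have "(- \<infinity> :: ereal) - 1 = - \<infinity>" by (simp add: one_ereal_def)
  with assms MInf show ?thesis by (simp add: conj_exponent_def divide_ereal_def)
qed (use assms in \<open>auto simp: conj_exponent_def\<close>)

lemma conj_exponent_ereal:
  "1 < r \<Longrightarrow> conj_exponent (ereal r) = ereal (r / (r - 1))"
  by (simp add: conj_exponent_def one_ereal_def)

text \<open>Here N - 2 = \<open>s\<^sup>2 - 1\<close> and N - 10 = \<open>s\<^sup>2 - 9\<close>, and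
  the numerator is \<open>(s - 1)^3 * (s + 3)\<close>; the common factor
  \<open>(s - 1) * (s + 3)\<close> cancels.\<close>

lemma p_c_eq:
  assumes "11 \<le> N" and s: "s = sqrt (real N - 1)"
  shows "p_c N = (s - 1)\<^sup>2 / ((s + 1) * (s - 3))" and "3 < s"
proof -
  have N: "real N = s\<^sup>2 + 1" using assms by simp
  show "3 < s" unfolding s using assms(1) by (intro real_less_rsqrt) simp
  have "p_c N = ((s\<^sup>2 - 1)\<^sup>2 - 4 * (s\<^sup>2 + 1) + 8 * s) / ((s\<^sup>2 - 1) * (s\<^sup>2 - 9))"
    unfolding p_c_def s[symmetric] using N by (simp add: s[symmetric] power2_eq_square algebra_simps)
  also have "(s\<^sup>2 - 1)\<^sup>2 - 4 * (s\<^sup>2 + 1) + 8 * s = (s - 1)\<^sup>2 * ((s - 1) * (s + 3))" by algebra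
  also have "(s\<^sup>2 - 1) * (s\<^sup>2 - 9) = ((s + 1) * (s - 3)) * ((s - 1) * (s + 3))" by algebra
  also have "(s - 1)\<^sup>2 * ((s - 1) * (s + 3)) / (((s + 1) * (s - 3)) * ((s - 1) * (s + 3)))
      = (s - 1)\<^sup>2 / ((s + 1) * (s - 3))"
    using \<open>3 < s\<close> by (intro mult_divide_mult_cancel_right) auto
  finally show "p_c N = (s - 1)\<^sup>2 / ((s + 1) * (s - 3))" .
qed

text \<open>For N \<le> 9 the right-hand side is at least 10; for N = 10 a finite exponent forces q
  > 1 and hence strictness. For N \<ge> 11 the bound by \<open>p_c\<close> leads to
  \<open>s - 1 < 2 * sqrt q\<close> with N = \<open>s\<^sup>2 + 1\<close>.\<close>

lemma subcritical_dimension: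
  assumes p0: "1 < conj_exponent (ereal q)" and "1 \<le> q"
    and "N \<le> 9 \<or> N = 10 \<and> conj_exponent (ereal q) < \<infinity>
      \<or> 11 \<le> N \<and> conj_exponent (ereal q) < ereal (p_c N)"
  shows "real N < 4 * q + 4 * sqrt q + 2"
proof -
  have q_gt: "1 < q" if "conj_exponent (ereal q) < \<infinity>"
    using that \<open>1 \<le> q\<close> by (cases "q = 1") (auto simp: conj_exponent_def one_ereal_def)
  have sq: "1 \<le> sqrt q" using \<open>1 \<le> q\<close> by simp
  consider "N \<le> 9" | "N = 10" "1 < q" | "11 \<le> N" "conj_exponent (ereal q) < ereal (p_c N)" "1 < q"
    using assms(3) q_gt less_ereal.simps(2) by (metis ereal_less_PInfty less_trans)
  then show ?thesis
  proof cases
    case 1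
    then have "real N \<le> 9" by simp
    with sq \<open>1 \<le> q\<close> show ?thesis by linarith
  next
    case 2
    then have "real N = 10" by simp
    with sq 2(2) show ?thesis by linarith
  next
    case 3
    define s where "s = sqrt (real N - 1)"
    note p_c = p_c_eq[OF 3(1) s_def]
    have N: "real N = s\<^sup>2 + 1" using 3(1) by (simp add: s_def)
    have "q / (q - 1) < (s - 1)\<^sup>2 / ((s + 1) * (s - 3))"
      using 3 by (simp add: conj_exponent_ereal p_c(1))
    then have "q < (s - 1)\<^sup>2 * (q - 1) / ((s + 1) * (s - 3))"
      using 3(3) by (simp only: pos_divide_less_eq diff_gt_0_iff_gt times_divide_eq_left)
    then have "q * ((s + 1) * (s - 3)) < (s - 1)\<^sup>2 * (q - 1)"
      using p_c(2) by (simp only: pos_less_divide_eq mult_pos_pos)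
    \<comment> \<open>The terms in \<open>q\<close> combine because
      \<open>(s - 1)\<^sup>2 - (s + 1) * (s - 3) = 4\<close>.\<close>
    then have "(s - 1)\<^sup>2 < 4 * q" by (simp add: power2_eq_square algebra_simps)
    then have "(s - 1)\<^sup>2 < (2 * sqrt q)\<^sup>2" using \<open>1 \<le> q\<close> by (simp add: power_mult_distrib)
    then have "s - 1 < 2 * sqrt q" by (rule power_less_imp_less_base) (use sq in simp)
    then have "s\<^sup>2 < (2 * sqrt q + 1)\<^sup>2" using p_c(2) by (intro power_strict_mono) auto
    also have "\<dots> = 4 * q + 4 * sqrt q + 1"
      using \<open>1 \<le> q\<close> by (simp add: power2_sum power_mult_distrib)
    finally show ?thesis using N by simp
  qed
qed

section \<open>Convexity and differential inequalities from bounds on \<open>q_fun\<close>\<close>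

text \<open>Adding the tangent inequalities at \<open>s\<close> and \<open>t\<close> eliminates the
  values of \<open>f\<close>. Together with \<open>nonneg_deriv_of_mono\<close> this gives the sign
  of the second derivative.\<close>

lemma convex_deriv_mono:
  fixes f :: "real \<Rightarrow> real"
  assumes "convex_on {0<..} f" and "\<And>t. 0 < t \<Longrightarrow> (f has_real_derivative f' t) (at t)"
    and "0 < s" "s \<le> t"
  shows "f' s \<le> f' t"
proof (cases "s = t")
  case False
  have "f' x * (y - x) \<le> f y - f x" if "0 < x" "0 < y" for x y
  proof (rule convex_on_imp_above_tangent[OF assms(1)])
    show "(f has_real_derivative f' x) (at x within {0<..})"
      using assms(2)[OF that(1)] by (rule has_field_derivative_at_within)
  qed (use that in \<open>auto simp: interior_open\<close>)
  from this[of s t] this[of t s] have "f' s * (t - s) \<le> f' t * (t - s)"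
    using assms(3,4) by (simp add: algebra_simps)
  then show ?thesis using False assms(4) by simp
qed simp

lemma nonneg_deriv_of_mono:
  fixes h :: "real \<Rightarrow> real"
  assumes "(h has_real_derivative D) (at t)" "0 < t" "\<And>s s'. 0 < s \<Longrightarrow> s \<le> s' \<Longrightarrow> h s \<le> h s'"
  shows "0 \<le> D"
proof (rule tendsto_lowerbound)
  show "((\<lambda>y. (h y - h t) / (y - t)) \<longlongrightarrow> D) (at_right t)"
    using has_field_derivative_at_within[OF assms(1), of "{t<..}"] by (simp add: has_field_derivative_iff)
  show "\<forall>\<^sub>F y in at_right t. 0 \<le> (h y - h t) / (y - t)"
    unfolding eventually_at_right_field using assms(2,3) by (intro exI[of _ "t + 1"]) auto
qed simp

text \<open>A finite upper bound excludes the value infinity given to \<open>q_fun\<close> where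
  \<open>f f''\<close> vanishes, so this product is positive and can be cleared.\<close>

lemma q_fun_lessD:
  assumes "q_fun f t < ereal Q" "0 < f t" "0 \<le> deriv (deriv f) t" "0 < Q"
  shows "1 / Q * (deriv f t)\<^sup>2 \<le> f t * deriv (deriv f) t"
proof -
  have ne: "f t * deriv (deriv f) t \<noteq> 0" using assms(1) by (auto simp: q_fun_def split: if_splits)
  with assms(2,3) have pos: "0 < f t * deriv (deriv f) t" by (simp add: zero_less_mult_iff less_le)
  have "(deriv f t)\<^sup>2 / (f t * deriv (deriv f) t) < Q" using assms(1) by (simp only: q_fun_def if_P[OF ne] less_ereal.simps(1))
  with pos assms(4) show ?thesis by (simp add: field_simps)
qed

lemma q_fun_greaterD:
  assumes "ereal Q < q_fun f t" "0 < f t" "0 \<le> deriv (deriv f) t" "0 < Q"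
  shows "f t * deriv (deriv f) t \<le> 1 / Q * (deriv f t)\<^sup>2"
proof (cases "f t * deriv (deriv f) t = 0")
  case True
  show ?thesis unfolding True using assms(4) by simp
next
  case False
  with assms(2,3) have pos: "0 < f t * deriv (deriv f) t" by (simp add: zero_less_mult_iff less_le)
  have "Q < (deriv f t)\<^sup>2 / (f t * deriv (deriv f) t)" using assms(1) by (simp only: q_fun_def if_P[OF False] less_ereal.simps(1))
  with pos assms(4) show ?thesis by (simp add: field_simps)
qed


subsection \<open>Functions of class C1 and C2, and integration by parts\<close>

lemma GDERIV_grad:
  fixes g :: "real ^ 'n \<Rightarrow> real"
  assumes "g differentiable (at x)"
  shows "GDERIV g x :> grad g x"
proof -
  obtain D where D: "(g has_derivative D) (at x)"
    using assms unfolding differentiable_def by blast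
  \<comment> \<open>The adjoint of the linear form \<open>D\<close> sends 1 to its Riesz
    vector.\<close>
  have "D = (\<lambda>h. inner h (adjoint D 1))"
    using adjoint_works[OF has_derivative_linear[OF D], of _ 1] by auto
  with D have "GDERIV g x :> adjoint D 1" by (simp add: gderiv_def)
  then show ?thesis using grad_eqI by metis
qed

lemma C1_GDERIV: "C1 g \<Longrightarrow> GDERIV g x :> grad g x"
  by (simp add: C1_def GDERIV_grad)

lemma C1_continuous_grad: "C1 g \<Longrightarrow> continuous_on UNIV (grad g)"
  by (simp add: C1_def)

lemma C1_continuous: "C1 g \<Longrightarrow> continuous_on UNIV g"
  by (simp add: C1_def differentiable_imp_continuous_within continuous_at_imp_continuous_on)

lemma C1_gradI:
  assumes "\<And>x. GDERIV g x :> G x" "continuous_on UNIV G"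
  shows "C1 g" and "grad g x = G x"
proof -
  have eq: "grad g = G" using grad_eqI[OF assms(1)] by blast
  then show "grad g x = G x" by simp
  show "C1 g" unfolding C1_def eq
    using assms by (auto simp: gderiv_def differentiable_def)
qed

lemma
  assumes "C1 a" "C1 b"
  shows C1_add: "C1 (\<lambda>x. a x + b x)"
    and grad_add: "grad (\<lambda>x. a x + b x) x = grad a x + grad b x"
proof -
  have "GDERIV (\<lambda>x. a x + b x) x :> grad a x + grad b x" for x
    using assms by (intro GDERIV_add C1_GDERIV)
  moreover have "continuous_on UNIV (\<lambda>x. grad a x + grad b x)"
    using assms by (intro continuous_intros C1_continuous_grad)
  ultimately show "C1 (\<lambda>x. a x + b x)" "grad (\<lambda>x. a x + b x) x = grad a x + grad b x"
    by (rule C1_gradI)+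
qed

lemma
  assumes "C1 a" "C1 b"
  shows C1_mult: "C1 (\<lambda>x. a x * b x)"
    and grad_mult: "grad (\<lambda>x. a x * b x) x = a x *\<^sub>R grad b x + b x *\<^sub>R grad a x"
proof -
  have "GDERIV (\<lambda>x. a x * b x) x :> a x *\<^sub>R grad b x + b x *\<^sub>R grad a x" for x
    using assms by (intro GDERIV_mult C1_GDERIV)
  moreover have "continuous_on UNIV (\<lambda>x. a x *\<^sub>R grad b x + b x *\<^sub>R grad a x)"
    using assms by (intro continuous_intros C1_continuous_grad C1_continuous)
  ultimately show "C1 (\<lambda>x. a x * b x)"
      "grad (\<lambda>x. a x * b x) x = a x *\<^sub>R grad b x + b x *\<^sub>R grad a x"
    by (rule C1_gradI)+
qed

lemma
  fixes a :: "real ^ 'n \<Rightarrow> real"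
  assumes "C1 a" "\<And>t. (h has_real_derivative h' t) (at t)" "continuous_on UNIV h'"
  shows C1_compose: "C1 (\<lambda>x. h (a x))"
    and grad_compose: "grad (\<lambda>x. h (a x)) x = h' (a x) *\<^sub>R grad a x"
proof -
  have "GDERIV (\<lambda>x. h (a x)) x :> h' (a x) *\<^sub>R grad a x" for x
    using C1_GDERIV[OF assms(1)] assms(2) by (rule GDERIV_DERIV_compose)
  moreover have "continuous_on UNIV (\<lambda>x. h' (a x) *\<^sub>R grad a x)"
    using assms by (intro continuous_intros continuous_on_compose2[OF assms(3)] C1_continuous C1_continuous_grad) auto
  ultimately show "C1 (\<lambda>x. h (a x))" "grad (\<lambda>x. h (a x)) x = h' (a x) *\<^sub>R grad a x"
    by (rule C1_gradI)+
qed

lemma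
  fixes i :: "'n::finite"
  shows C1_component: "C1 (\<lambda>x :: real ^ 'n. x $ i)"
    and grad_component: "grad (\<lambda>x :: real ^ 'n. x $ i) x = axis i 1"
proof -
  have "GDERIV (\<lambda>x :: real ^ 'n. x $ i) x :> axis i 1" for x
    using bounded_linear_imp_has_derivative[OF bounded_linear_vec_nth] by (simp add: gderiv_def inner_axis)
  then show "C1 (\<lambda>x :: real ^ 'n. x $ i)" "grad (\<lambda>x :: real ^ 'n. x $ i) x = axis i 1"
    by (rule C1_gradI; intro continuous_intros)+
qed

lemma grad_eq_0_outside:
  fixes g :: "real ^ 'n \<Rightarrow> real"
  assumes "\<And>x. r < norm x \<Longrightarrow> g x = 0" "r < norm x"
  shows "grad g x = 0"
proof (rule grad_eqI, unfold gderiv_def)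
  have "open {x :: real ^ 'n. r < norm x}" by (intro open_Collect_less continuous_intros)
  then show "(g has_derivative (\<lambda>h. inner h 0)) (at x)"
    by (rule has_derivative_transform_within_open[of "\<lambda>_. 0", rotated]) (use assms in auto)
qed

section \<open>Integrals of compactly supported functions\<close>

lemma integrable_compactly_supported:
  fixes h :: "'a::euclidean_space \<Rightarrow> real"
  assumes "continuous_on UNIV h" "\<And>x. r < norm x \<Longrightarrow> h x = 0"
  shows "integrable lborel h"
proof -
  have "integrable lborel (\<lambda>x. indicator (cball 0 r) x *\<^sub>R h x)"
    by (intro borel_integrable_compact continuous_on_subset[OF assms(1)]) auto
  also have "(\<lambda>x. indicator (cball 0 r) x *\<^sub>R h x) = h"
    using assms(2) by (force simp: indicator_def fun_eq_iff)
  finally show ?thesis .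
qed

lemma integral_lborel_translate:
  fixes h :: "'a::euclidean_space \<Rightarrow> real"
  assumes "h \<in> borel_measurable borel"
  shows "(\<integral>x. h (c + x) \<partial>lborel) = (\<integral>x. h x \<partial>lborel)"
proof -
  have "(\<integral>x. h x \<partial>lborel) = (\<integral>x. h x \<partial>(distr lborel borel ((+) c)))"
    by (simp add: lborel_distr_plus)
  also have "\<dots> = (\<integral>x. h (c + x) \<partial>lborel)"
    by (rule integral_distr) (use assms in auto)
  finally show ?thesis by simp
qed

text \<open>The integral of every difference quotient vanishes by translation invariance of Lebesgue
  measure, so no Fubini argument is needed.\<close>

lemma integral_partial_derivative_eq_0:
  fixes g :: "real ^ 'n \<Rightarrow> real"
  assumes "C1 g" and supp: "\<And>x. r < norm x \<Longrightarrow> g x = 0"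
  shows "(\<integral>x. grad g x $ i \<partial>lborel) = 0"
proof -
  let ?e = "axis i 1 :: real ^ 'n"
  have "compact (grad g ` cball 0 r)"
    by (intro compact_continuous_image continuous_on_subset[OF C1_continuous_grad[OF assms(1)]]) auto
  then obtain M where "0 < M" and M: "\<And>x. x \<in> cball 0 r \<Longrightarrow> norm (grad g x) \<le> M"
    using compact_imp_bounded bounded_pos by (metis imageI)
  have M: "norm (grad g x) \<le> M" for x
    using M[of x] grad_eq_0_outside[of r g x] supp \<open>0 < M\<close> by (cases "norm x \<le> r") auto
  have lip: "\<bar>g y - g x\<bar> \<le> M * norm (y - x)" for x y
  proof -
    have "norm (g y - g x) \<le> M * norm (y - x)"
    proof (rule differentiable_bound[of UNIV g "\<lambda>x h. inner h (grad g x)"])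
      show "(g has_derivative (\<lambda>h. inner h (grad g x))) (at x within UNIV)" for x
        using C1_GDERIV[OF assms(1), of x] by (simp add: gderiv_def)
      show "onorm (\<lambda>h. inner h (grad g x)) \<le> M" for x
      proof (rule onorm_bound)
        fix h
        have "norm (inner h (grad g x)) \<le> norm h * norm (grad g x)"
          using Cauchy_Schwarz_ineq2 by simp
        also have "\<dots> \<le> M * norm h" using M[of x] by (simp add: mult.commute[of M] mult_left_mono)
        finally show "norm (inner h (grad g x)) \<le> M * norm h" .
      qed (use \<open>0 < M\<close> in simp)
    qed auto
    then show ?thesis by simp
  qed
  define t where "t n = inverse (real (Suc n))" for n
  have t: "0 < t n" "t n \<le> 1" for n by (auto simp: t_def field_simps)
  define s where "s n x = (g (t n *\<^sub>R ?e + x) - g x) / t n" for n x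
  note g_cont = C1_continuous[OF assms(1)]
  have g_meas: "g \<in> borel_measurable borel" using g_cont by (rule borel_measurable_continuous_onI)
  have int_g: "integrable lborel g" using integrable_compactly_supported[OF g_cont supp] .
  have shift_cont: "continuous_on UNIV (\<lambda>x. g (t n *\<^sub>R ?e + x))" for n
    by (intro continuous_on_compose2[OF g_cont] continuous_intros) auto
  have shift_norm: "norm x - 1 \<le> norm (t n *\<^sub>R ?e + x)" for n x
    using norm_triangle_ineq2[of x "- (t n *\<^sub>R ?e)"] t[of n] by (simp add: add.commute)
  have int_shift: "integrable lborel (\<lambda>x. g (t n *\<^sub>R ?e + x))" for n
  proof (rule integrable_compactly_supported[OF shift_cont, of "r + 1"])
    fix x :: "real ^ 'n" assume "r + 1 < norm x"
    then show "g (t n *\<^sub>R ?e + x) = 0" using shift_norm[of x n] by (intro supp) simp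
  qed
  have "(\<integral>x. s n x \<partial>lborel) = 0" for n
    unfolding s_def using int_g int_shift integral_lborel_translate[OF g_meas] by simp
  moreover have "(\<lambda>n. \<integral>x. s n x \<partial>lborel) \<longlonglongrightarrow> (\<integral>x. grad g x $ i \<partial>lborel)"
  \<comment> \<open>The Lipschitz bound limits every quotient by \<open>M\<close>, and since the
    steps \<open>t n\<close> are at most 1, all quotients vanish beyond radius
    \<open>r + 1\<close>.\<close>
  proof (rule integral_dominated_convergence[where w = "\<lambda>x. M * indicator (cball 0 (r + 1)) x"])
    show "(\<lambda>x. grad g x $ i) \<in> borel_measurable lborel"
      using C1_continuous_grad[OF assms(1)] by (auto intro!: borel_measurable_continuous_onI continuous_intros)
    show "s n \<in> borel_measurable lborel" for n
      unfolding s_def using g_meas borel_measurable_continuous_onI[OF shift_cont[of n]] by simp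
    show "integrable lborel (\<lambda>x. M * indicator (cball 0 (r + 1)) x :: real)"
      by (intro integrable_mult_right integrable_real_indicator) (use emeasure_lborel_cball_finite in auto)
    show "AE x in lborel. norm (s n x) \<le> M * indicator (cball 0 (r + 1)) x" for n
    proof (rule AE_I2)
      fix x :: "real ^ 'n"
      show "norm (s n x) \<le> M * indicator (cball 0 (r + 1)) x"
      proof (cases "norm x \<le> r + 1")
        case True
        have "\<bar>g (t n *\<^sub>R ?e + x) - g x\<bar> \<le> M * t n"
          using lip[of "t n *\<^sub>R ?e + x" x] t[of n] by simp
        with True t[of n] show ?thesis by (simp add: s_def field_simps)
      next
        case False
        then have "g (t n *\<^sub>R ?e + x) = 0" "g x = 0"
          using shift_norm[of x n] by (auto intro!: supp)
        with False show ?thesis by (simp add: s_def)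
      qed
    qed
    show "AE x in lborel. (\<lambda>n. s n x) \<longlonglongrightarrow> grad g x $ i"
    proof (rule AE_I2)
      fix x :: "real ^ 'n"
      have "((\<lambda>\<tau>. g (\<tau> *\<^sub>R ?e + x)) has_derivative (\<lambda>\<tau>. inner (\<tau> *\<^sub>R ?e) (grad g x))) (at 0)"
        using C1_GDERIV[OF assms(1), of x, unfolded gderiv_def]
        by (intro has_derivative_compose[of "\<lambda>\<tau>. \<tau> *\<^sub>R ?e + x" "\<lambda>\<tau>. \<tau> *\<^sub>R ?e" 0 UNIV g])
          (auto intro!: derivative_eq_intros)
      also have "(\<lambda>\<tau>. inner (\<tau> *\<^sub>R ?e) (grad g x)) = (*) (grad g x $ i)"
        by (auto simp: inner_axis' mult.commute)
      finally have "((\<lambda>\<tau>. (g (\<tau> *\<^sub>R ?e + x) - g x) / \<tau>) \<longlongrightarrow> grad g x $ i) (at 0)"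
        unfolding has_field_derivative_def[symmetric] has_field_derivative_iff by simp
      moreover have "filterlim t (at 0) sequentially"
        unfolding filterlim_at t_def using LIMSEQ_inverse_real_of_nat by auto
      ultimately show "(\<lambda>n. s n x) \<longlonglongrightarrow> grad g x $ i"
        unfolding s_def by (rule filterlim_compose)
    qed
  qed
  ultimately show ?thesis by (simp add: LIMSEQ_const_iff)
qed

lemma C2_C1: "C2 g \<Longrightarrow> C1 g" and C2_C1_grad: "C2 g \<Longrightarrow> C1 (\<lambda>x. grad g x $ i)"
  by (auto simp: C2_def)

text \<open>Stability is tested with \<open>\<psi>(u)\<zeta>\<close>. The gradient of \<open>u\<close> drops out
  because the quadratic term is the divergence of \<open>\<phi>(u)\<zeta>\<^sup>2\<nabla>u + K(u)\<nabla>\<zeta>\<^sup>2\<close> up to terms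
  without \<open>\<nabla>u\<close>, where \<open>K = \<psi>\<^sup>2/2 - \<Phi>\<close>.\<close>

lemma stability_inequality:
  fixes u \<zeta> :: "real ^ 'n \<Rightarrow> real"
  assumes stable: "stable_solution f u"
    and \<psi>: "\<And>t. (\<psi> has_real_derivative \<psi>' t) (at t)" "continuous_on UNIV \<psi>'"
    and \<phi>: "\<And>t. (\<phi> has_real_derivative (\<psi>' t)\<^sup>2) (at t)"
    and \<Phi>: "\<And>t. (\<Phi> has_real_derivative \<phi> t) (at t)"
    and \<zeta>: "C1 \<zeta>" "C2 (\<lambda>x. (\<zeta> x)\<^sup>2)" and supp: "\<And>x. r < norm x \<Longrightarrow> \<zeta> x = 0"
  defines "B \<equiv> \<lambda>x. f (u x) * \<phi> (u x) * (\<zeta> x)\<^sup>2 + (\<psi> (u x))\<^sup>2 * (norm (grad \<zeta> x))\<^sup>2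
      - ((\<psi> (u x))\<^sup>2 / 2 - \<Phi> (u x)) * laplacian (\<lambda>x. (\<zeta> x)\<^sup>2) x"
  shows "integrable lborel B"
    and "(\<integral>x. deriv f (u x) * (\<psi> (u x) * \<zeta> x)\<^sup>2 \<partial>lborel) \<le> (\<integral>x. B x \<partial>lborel)"
proof -
  define Z where "Z = (\<lambda>x. (\<zeta> x)\<^sup>2)"
  define K where "K t = (\<psi> t)\<^sup>2 / 2 - \<Phi> t" for t
  define v where "v x = \<psi> (u x) * \<zeta> x" for x
  define F where "F i x = \<phi> (u x) * Z x * grad u x $ i + K (u x) * grad Z x $ i" for i x
  have u: "C2 u" "\<And>x. - laplacian u x = f (u x)"
    using stable by (auto simp: stable_solution_def is_solution_def)
  have Z: "C2 Z" using \<zeta>(2) by (simp add: Z_def)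
  note C1s = C2_C1[OF u(1)] C2_C1[OF Z] C2_C1_grad[OF u(1)] C2_C1_grad[OF Z] \<zeta>(1)
  have \<phi>_cont: "continuous_on UNIV \<phi>" "continuous_on UNIV \<psi>"
    by (intro continuous_at_imp_continuous_on ballI DERIV_isCont[OF \<phi>] DERIV_isCont[OF \<psi>(1)])+
  have K: "(K has_real_derivative \<psi> t * \<psi>' t - \<phi> t) (at t)" for t
    unfolding K_def by (auto intro!: derivative_eq_intros \<psi> \<Phi>)
  have K_cont: "continuous_on UNIV (\<lambda>t. \<psi> t * \<psi>' t - \<phi> t)"
    by (intro continuous_intros \<phi>_cont \<psi>)
  have \<phi>'_cont: "continuous_on UNIV (\<lambda>t. (\<psi>' t)\<^sup>2)" by (intro continuous_intros \<psi>)
  note C1_u = C1_compose[OF C1s(1) \<psi>] C1_compose[OF C1s(1) \<phi> \<phi>'_cont] C1_compose[OF C1s(1) K K_cont]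
  note grad_u = grad_compose[OF C1s(1) \<psi>] grad_compose[OF C1s(1) \<phi> \<phi>'_cont] grad_compose[OF C1s(1) K K_cont]
  have C1_v: "C1 v" unfolding v_def by (intro C1_mult C1_u C1s)
  have C1_F: "C1 (F i)" for i unfolding F_def by (intro C1_add C1_mult C1_u C1s)
  have grad_v: "grad v x = \<psi> (u x) *\<^sub>R grad \<zeta> x + (\<zeta> x * \<psi>' (u x)) *\<^sub>R grad u x" for x
    unfolding v_def by (simp add: grad_mult C1_u C1s grad_u)
  have grad_Z: "grad Z x = (2 * \<zeta> x) *\<^sub>R grad \<zeta> x" for x
    unfolding Z_def power2_eq_square by (simp add: grad_mult C1s scaleR_2 flip: scaleR_add_left)
  \<comment> \<open>Differentiating \<open>Z\<close> in the first summand gives \<phi>(u) times the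
    product of the partial derivatives of \<open>u\<close> and \<open>Z\<close>; it cancels against
    the part -\<phi> of the derivative of \<open>K\<close>.\<close>
  have grad_F: "grad (F i) x $ i =
      \<phi> (u x) * Z x * grad (\<lambda>x. grad u x $ i) x $ i + K (u x) * grad (\<lambda>x. grad Z x $ i) x $ i
      + \<psi> (u x) * \<psi>' (u x) * (grad u x $ i * grad Z x $ i)
      + (\<psi>' (u x))\<^sup>2 * Z x * (grad u x $ i * grad u x $ i)" for i x
    unfolding F_def by (simp add: grad_add grad_mult C1_mult C1_u C1s grad_u algebra_simps)
  have div_F: "(\<Sum>i\<in>UNIV. grad (F i) x $ i) = \<phi> (u x) * Z x * laplacian u x + K (u x) * laplacian Z x
      + \<psi> (u x) * \<psi>' (u x) * inner (grad u x) (grad Z x)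
      + (\<psi>' (u x))\<^sup>2 * Z x * inner (grad u x) (grad u x)" for x
    unfolding grad_F sum.distrib laplacian_def inner_vec_def sum_distrib_left inner_real_def by simp
  have "(norm (grad v x))\<^sup>2 = (\<psi> (u x))\<^sup>2 * (norm (grad \<zeta> x))\<^sup>2
      + \<psi> (u x) * \<psi>' (u x) * inner (grad u x) (grad Z x)
      + (\<psi>' (u x))\<^sup>2 * Z x * inner (grad u x) (grad u x)" for x
    unfolding grad_v grad_Z power2_norm_eq_inner
    by (simp add: Z_def inner_add_left inner_add_right inner_commute power2_eq_square algebra_simps)
  then have split: "(norm (grad v x))\<^sup>2 - (\<Sum>i\<in>UNIV. grad (F i) x $ i) = B x" for x
    unfolding div_F B_def Z_def[symmetric] K_def[symmetric] u(2)[symmetric]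
    by (simp add: algebra_simps Z_def)
  have Z_supp: "Z x = 0" if "r < norm x" for x using supp[OF that] by (simp add: Z_def)
  have v_supp: "v x = 0" if "r < norm x" for x using supp[OF that] by (simp add: v_def)
  have F_supp: "F i x = 0" if "r < norm x" for i x
    using grad_eq_0_outside[of r Z x] Z_supp that by (simp add: F_def)
  have "continuous_on UNIV (\<lambda>x. (norm (grad v x))\<^sup>2)"
    by (intro continuous_intros C1_continuous_grad C1_v)
  then have int_v: "integrable lborel (\<lambda>x. (norm (grad v x))\<^sup>2)"
    by (rule integrable_compactly_supported[of _ r]) (use grad_eq_0_outside[of r v] v_supp in simp)
  have int_F: "integrable lborel (\<lambda>x. grad (F i) x $ i)" for i
  proof (rule integrable_compactly_supported)
    show "continuous_on UNIV (\<lambda>x. grad (F i) x $ i)"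
      by (intro continuous_intros C1_continuous_grad C1_F)
    show "grad (F i) x $ i = 0" if "r < norm x" for x
      using grad_eq_0_outside[of r "F i" x] F_supp that by simp
  qed
  have "integrable lborel (\<lambda>x. (norm (grad v x))\<^sup>2 - (\<Sum>i\<in>UNIV. grad (F i) x $ i))"
    using int_v int_F by (intro Bochner_Integration.integrable_diff Bochner_Integration.integrable_sum)
  then show "integrable lborel B" by (simp add: split)
  have "closure {x. v x \<noteq> 0} \<subseteq> cball 0 r"
  proof (rule closure_minimal)
    show "{x. v x \<noteq> 0} \<subseteq> cball 0 r"
    proof
      fix x assume "x \<in> {x. v x \<noteq> 0}"
      then show "x \<in> cball 0 r" using v_supp[of x] by (cases "r < norm x") auto
    qed
  qed simp
  then have "compact (closure {x. v x \<noteq> 0})"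
    using compact_Int_closed[OF compact_cball[of "0 :: real ^ 'n" r] closed_closure, of "{x. v x \<noteq> 0}"]
    by (simp add: Int_absorb1)
  then have "(\<integral>x. deriv f (u x) * (v x)\<^sup>2 \<partial>lborel) \<le> (\<integral>x. (norm (grad v x))\<^sup>2 \<partial>lborel)"
    using stable C1_v by (simp add: stable_solution_def C1_compact_def)
  \<comment> \<open>The field \<open>F\<close> has compact support, so subtracting its divergence
    does not change the integral; by \<open>split\<close> the integrand becomes
    \<open>B\<close>.\<close>
  also have "\<dots> = (\<integral>x. (norm (grad v x))\<^sup>2 - (\<Sum>i\<in>UNIV. grad (F i) x $ i) \<partial>lborel)"
    using int_v int_F integral_partial_derivative_eq_0[OF C1_F F_supp] by simp
  finally show "(\<integral>x. deriv f (u x) * (\<psi> (u x) * \<zeta> x)\<^sup>2 \<partial>lborel) \<le> (\<integral>x. B x \<partial>lborel)"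
    by (simp add: split v_def)
qed

subsection \<open>Cutoff functions\<close>

text \<open>At the kink the difference quotient is at most \<open>\<bar>y\<bar> ^ k\<close>, which
  tends to 0 because \<open>k\<close> is at least 1.\<close>

lemma deriv_max_power:
  assumes "1 \<le> k"
  shows "((\<lambda>s :: real. max 0 s ^ Suc k) has_real_derivative real (Suc k) * max 0 s ^ k) (at s)"
proof -
  consider "0 < s" | "s < 0" | "s = 0" by linarith
  then show ?thesis
  proof cases
    case 1
    have "((\<lambda>s :: real. s ^ Suc k) has_real_derivative real (Suc k) * max 0 s ^ k) (at s)"
      using 1 by (auto intro!: derivative_eq_intros simp del: power_Suc)
    then show ?thesis
      by (rule has_field_derivative_transform_within_open[where S = "{0<..}"]) (use 1 in auto)
  next
    case 2
    have "((\<lambda>s :: real. 0) has_real_derivative real (Suc k) * max 0 s ^ k) (at s)"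
      using 2 assms by (simp add: power_0_left)
    then show ?thesis
      by (rule has_field_derivative_transform_within_open[where S = "{..<0}"]) (use 2 in auto)
  next
    case 3
    have "((\<lambda>y :: real. \<bar>y\<bar> ^ k) \<longlongrightarrow> \<bar>0\<bar> ^ k) (at 0)" by (intro tendsto_intros)
    then have lim: "((\<lambda>y :: real. \<bar>y\<bar> ^ k) \<longlongrightarrow> 0) (at 0)" using assms by (simp add: power_0_left)
    have "((\<lambda>y :: real. (max 0 y ^ Suc k - max 0 0 ^ Suc k) / (y - 0)) \<longlongrightarrow> 0) (at 0)"
    proof (rule Lim_null_comparison[OF _ lim])
      show "\<forall>\<^sub>F y :: real in at 0. norm ((max 0 y ^ Suc k - max 0 0 ^ Suc k) / (y - 0)) \<le> \<bar>y\<bar> ^ k"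
        by (intro always_eventually) (auto simp: max_def)
    qed
    with 3 assms show ?thesis by (simp add: has_field_derivative_iff power_0_left)
  qed
qed

context
  fixes R :: real and \<rho> :: "real ^ 'n \<Rightarrow> real"
  assumes R: "0 < R"
  defines "\<rho> \<equiv> \<lambda>x. 1 - inner x x / R\<^sup>2"
begin

lemma C1_cutoff_base: "C1 \<rho>" and grad_cutoff_base: "grad \<rho> x = (- 2 / R\<^sup>2) *\<^sub>R x"
proof -
  have "GDERIV \<rho> x :> (- 2 / R\<^sup>2) *\<^sub>R x" for x
    unfolding \<rho>_def gderiv_def divide_inverse
    by (rule derivative_eq_intros refl)+ (simp add: fun_eq_iff inner_commute)
  then show "C1 \<rho>" "grad \<rho> x = (- 2 / R\<^sup>2) *\<^sub>R x"
    by (rule C1_gradI; intro continuous_intros)+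
qed

lemma
  assumes "1 \<le> k"
  shows C1_cutoff_power: "C1 (\<lambda>x. max 0 (\<rho> x) ^ Suc k)"
    and grad_cutoff_power:
      "grad (\<lambda>x. max 0 (\<rho> x) ^ Suc k) x = (- 2 * real (Suc k) / R\<^sup>2 * max 0 (\<rho> x) ^ k) *\<^sub>R x"
proof -
  have cont: "continuous_on UNIV (\<lambda>s :: real. real (Suc k) * max 0 s ^ k)" by (intro continuous_intros)
  show "C1 (\<lambda>x. max 0 (\<rho> x) ^ Suc k)"
    by (rule C1_compose[OF C1_cutoff_base deriv_max_power[OF assms] cont])
  show "grad (\<lambda>x. max 0 (\<rho> x) ^ Suc k) x = (- 2 * real (Suc k) / R\<^sup>2 * max 0 (\<rho> x) ^ k) *\<^sub>R x"
    unfolding grad_compose[OF C1_cutoff_base deriv_max_power[OF assms] cont] grad_cutoff_base scaleR_scaleR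
    by (rule arg_cong2[of _ _ _ _ scaleR]) (simp_all add: mult_ac del: of_nat_Suc)
qed

text \<open>Each component of the gradient is a linear function times a power that
  \<open>C1_cutoff_power\<close> already covers; hence the total exponent of at least 3.\<close>

lemma
  assumes "1 \<le> k"
  shows C2_cutoff_power: "C2 (\<lambda>x. max 0 (\<rho> x) ^ Suc (Suc k))"
    and laplacian_cutoff_power: "laplacian (\<lambda>x. max 0 (\<rho> x) ^ Suc (Suc k)) x =
      - 2 * real (Suc (Suc k)) / R\<^sup>2 *
        (real CARD('n) * max 0 (\<rho> x) ^ Suc k - 2 * real (Suc k) / R\<^sup>2 * max 0 (\<rho> x) ^ k * inner x x)"
proof -
  define c where "c = - 2 * real (Suc (Suc k)) / R\<^sup>2"
  have grad: "grad (\<lambda>x. max 0 (\<rho> x) ^ Suc (Suc k)) x $ i = (c * x $ i) * max 0 (\<rho> x) ^ Suc k" for x i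
    by (subst grad_cutoff_power) (auto simp: c_def simp del: power_Suc)
  have c: "C1 (\<lambda>x :: real ^ 'n. c * x $ i)" "grad (\<lambda>x :: real ^ 'n. c * x $ i) x = axis i c" for i x
    using C1_compose[OF C1_component, of "(*) c" "\<lambda>_. c" i] grad_compose[OF C1_component, of "(*) c" "\<lambda>_. c" i x]
    by (auto simp: grad_component vec_eq_iff axis_def intro!: derivative_eq_intros)
  note mult = C1_mult[OF c(1) C1_cutoff_power[OF assms]] grad_mult[OF c(1) C1_cutoff_power[OF assms]]
  show "C2 (\<lambda>x. max 0 (\<rho> x) ^ Suc (Suc k))"
    unfolding C2_def grad using mult(1) C1_cutoff_power[of "Suc k"] by simp
  have "laplacian (\<lambda>x. max 0 (\<rho> x) ^ Suc (Suc k)) x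
      = (\<Sum>i\<in>UNIV. c * max 0 (\<rho> x) ^ Suc k - c * (2 * real (Suc k) / R\<^sup>2) * max 0 (\<rho> x) ^ k * (x $ i * x $ i))"
    unfolding laplacian_def grad mult(2) grad_cutoff_power[OF assms] c(2)
    using R by (intro sum.cong refl) (simp add: field_simps del: power_Suc)
  also have "\<dots> = c * (real CARD('n) * max 0 (\<rho> x) ^ Suc k - 2 * real (Suc k) / R\<^sup>2 * max 0 (\<rho> x) ^ k * inner x x)"
    unfolding sum_subtractf inner_vec_def inner_real_def sum_distrib_left[symmetric]
    by (simp add: algebra_simps del: power_Suc)
  finally show "laplacian (\<lambda>x. max 0 (\<rho> x) ^ Suc (Suc k)) x =
      - 2 * real (Suc (Suc k)) / R\<^sup>2 *
        (real CARD('n) * max 0 (\<rho> x) ^ Suc k - 2 * real (Suc k) / R\<^sup>2 * max 0 (\<rho> x) ^ k * inner x x)"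
    by (simp only: c_def)
qed

lemma cutoff_supp: "R \<le> norm x \<Longrightarrow> max 0 (\<rho> x) = 0"
  using R power_mono[of R "norm x" 2] by (simp add: \<rho>_def power2_norm_eq_inner field_simps)

lemma cutoff_le_1: "max 0 (\<rho> x) \<le> 1"
  by (simp add: \<rho>_def)

text \<open>On the support \<open>inner x x\<close> is at most \<open>R\<^sup>2\<close>, and
  elsewhere the positive power vanishes. It removes the factors of \<open>x\<close> produced by
  differentiating \<rho>, so both bounds below are of order \<open>1 / R\<^sup>2\<close>.\<close>

lemma cutoff_mult_le: "0 < k \<Longrightarrow> max 0 (\<rho> x) ^ k * inner x x / R\<^sup>2 \<le> max 0 (\<rho> x) ^ k"
proof (cases "R \<le> norm x")
  case False
  then have "inner x x \<le> R\<^sup>2" using power_mono[of "norm x" R 2] by (simp add: power2_norm_eq_inner)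
  then have "max 0 (\<rho> x) ^ k * (inner x x / R\<^sup>2) \<le> max 0 (\<rho> x) ^ k * 1"
    using R by (intro mult_left_mono) auto
  then show ?thesis by simp
qed (simp add: cutoff_supp power_0_left)

lemma cutoff_grad_bound:
  assumes "1 \<le> k"
  shows "(norm (grad (\<lambda>x. max 0 (\<rho> x) ^ Suc k) x))\<^sup>2 \<le> 4 * (real (Suc k))\<^sup>2 / R\<^sup>2 * max 0 (\<rho> x) ^ (2 * k)"
proof -
  have "(norm (grad (\<lambda>x. max 0 (\<rho> x) ^ Suc k) x))\<^sup>2
      = 4 * (real (Suc k))\<^sup>2 / R\<^sup>2 * (max 0 (\<rho> x) ^ (2 * k) * inner x x / R\<^sup>2)"
    unfolding grad_cutoff_power[OF assms] norm_scaleR power_mult_distrib power2_abs power2_norm_eq_inner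
      power_even_eq
    using R by (simp add: power2_eq_square field_simps del: of_nat_Suc)
  also have "\<dots> \<le> 4 * (real (Suc k))\<^sup>2 / R\<^sup>2 * max 0 (\<rho> x) ^ (2 * k)"
    using assms by (intro mult_left_mono cutoff_mult_le) auto
  finally show ?thesis .
qed

text \<open>Used with \<open>2 * k\<close> in place of \<open>k\<close>: the Laplacian of
  \<open>\<zeta>\<^sup>2\<close> then carries the same power \<open>2 * k\<close> as the squared
  gradient of \<zeta>, two less than \<open>\<zeta>\<^sup>2\<close> itself.\<close>

lemma cutoff_laplacian_bound:
  assumes "1 \<le> k"
  shows "\<bar>laplacian (\<lambda>x. max 0 (\<rho> x) ^ Suc (Suc k)) x\<bar>
    \<le> 2 * real (Suc (Suc k)) * (real CARD('n) + 2 * real (Suc k)) / R\<^sup>2 * max 0 (\<rho> x) ^ k"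
proof -
  let ?w = "max 0 (\<rho> x)"
  have "?w ^ Suc k \<le> ?w ^ k"
    using cutoff_le_1[of x] by (intro power_decreasing) auto
  then have 1: "real CARD('n) * ?w ^ Suc k \<le> real CARD('n) * ?w ^ k"
    by (intro mult_left_mono) auto
  have 2: "2 * real (Suc k) * (?w ^ k * inner x x / R\<^sup>2) \<le> 2 * real (Suc k) * ?w ^ k"
    using assms by (intro mult_left_mono cutoff_mult_le) auto
  have pos: "0 \<le> real CARD('n) * ?w ^ Suc k" "0 \<le> 2 * real (Suc k) * (?w ^ k * inner x x / R\<^sup>2)"
    by auto
  have "\<bar>real CARD('n) * ?w ^ Suc k - 2 * real (Suc k) / R\<^sup>2 * ?w ^ k * inner x x\<bar>
    = \<bar>real CARD('n) * ?w ^ Suc k - 2 * real (Suc k) * (?w ^ k * inner x x / R\<^sup>2)\<bar>"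
    by (simp add: mult.assoc)
  also have "\<dots> \<le> real CARD('n) * ?w ^ k + 2 * real (Suc k) * ?w ^ k"
    using 1 2 pos by linarith
  finally have 3: "\<bar>real CARD('n) * ?w ^ Suc k - 2 * real (Suc k) / R\<^sup>2 * ?w ^ k * inner x x\<bar>
    \<le> (real CARD('n) + 2 * real (Suc k)) * ?w ^ k" by (simp add: algebra_simps)
  have "\<bar>laplacian (\<lambda>x. max 0 (\<rho> x) ^ Suc (Suc k)) x\<bar> = 2 * real (Suc (Suc k)) / R\<^sup>2 *
      \<bar>real CARD('n) * ?w ^ Suc k - 2 * real (Suc k) / R\<^sup>2 * ?w ^ k * inner x x\<bar>"
    unfolding laplacian_cutoff_power[OF assms] abs_mult by simp
  also have "\<dots> \<le> 2 * real (Suc (Suc k)) / R\<^sup>2 * ((real CARD('n) + 2 * real (Suc k)) * ?w ^ k)"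
    by (intro mult_left_mono 3) auto
  finally show ?thesis by (simp add: mult_ac del: of_nat_Suc power_Suc)
qed

end


subsection \<open>The Liouville theorem\<close>

text \<open>Here \<open>d\<close> is \<open>f'(u)\<close> and \<open>p\<close> is
  \<open>\<psi>(u)\<^sup>2\<close>. Either \<open>A / R\<^sup>2\<close> is below the fraction
  \<open>\<kappa> / 2 * d * w\<^sup>2\<close> and the term is absorbed, or \<open>d\<close> is small
  compared with \<open>1 / (R * w)^2\<close> and the growth bound makes the term small. This
  pointwise alternative plays the part of Young's inequality.\<close>

lemma absorb_or_decay:
  fixes d p w R A \<kappa> C e0 e1 :: real
  assumes "0 < d" "0 \<le> p" "0 \<le> w" "w \<le> 1" "0 < R" "0 < A" "0 < \<kappa>" "0 < C" "0 < e0" "0 < e1"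
    and k: "e0 \<le> real k" "e1 \<le> real k"
    and growth: "p \<le> C * (d powr e0 + d powr e1)"
  defines "E \<equiv> 2 * A / \<kappa> / R\<^sup>2"
  shows "p * (A / R\<^sup>2 * w ^ (2 * k))
    \<le> \<kappa> / 2 * (d * p) * w ^ (2 * k + 2) + A / R\<^sup>2 * C * (E powr e0 + E powr e1)"
proof -
  have rest: "0 \<le> A / R\<^sup>2 * C * (E powr e0 + E powr e1)" using assms by simp
  have main: "0 \<le> \<kappa> / 2 * (d * p) * w ^ (2 * k + 2)" using assms by simp
  have "1 \<le> k" using k \<open>0 < e0\<close> by linarith
  consider "w = 0" | "A / R\<^sup>2 \<le> \<kappa> / 2 * d * w\<^sup>2" | "0 < w" "\<kappa> / 2 * d * w\<^sup>2 < A / R\<^sup>2"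
    using \<open>0 \<le> w\<close> by linarith
  then show ?thesis
  proof cases
    case 1
    with \<open>1 \<le> k\<close> rest show ?thesis by (simp add: power_0_left)
  next
    case 2
    have "p * (A / R\<^sup>2 * w ^ (2 * k)) \<le> p * (\<kappa> / 2 * d * w\<^sup>2 * w ^ (2 * k))"
      using assms by (intro mult_left_mono mult_right_mono 2) auto
    also have "\<dots> = \<kappa> / 2 * (d * p) * w ^ (2 * k + 2)"
      by (simp add: power_add power2_eq_square mult_ac)
    finally show ?thesis using rest by linarith
  next
    case 3
    define y where "y = w\<^sup>2"
    have y: "0 < y" "y \<le> 1" using 3(1) \<open>w \<le> 1\<close> by (auto simp: y_def power_le_one)
    have "d \<le> E / y"
      using 3(2) y(1) \<open>0 < \<kappa>\<close> \<open>0 < R\<close> by (simp add: E_def field_simps flip: y_def)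
    have E: "0 \<le> E" using assms by (simp add: E_def)
    \<comment> \<open>As \<open>e \<le> k\<close> and \<open>y \<le> 1\<close>, the power
      \<open>y ^ k\<close> compensates the singular factor in \<open>d \<le> E / y\<close>.\<close>
    have decay: "d powr e * y ^ k \<le> E powr e" if "0 < e" "e \<le> real k" for e
    proof -
      have "y ^ k = y powr real k" using y(1) by (simp add: powr_realpow)
      also have "\<dots> \<le> y powr e" using y that by (intro powr_mono') auto
      finally have "d powr e * y ^ k \<le> (E / y) powr e * y powr e"
        using \<open>d \<le> E / y\<close> \<open>0 < d\<close> y(1) that(1) by (intro mult_mono powr_mono2) auto
      also have "\<dots> = E powr e" using y(1) E by (simp flip: powr_mult)
      finally show ?thesis .
    qed
    have "p * y ^ k \<le> C * (d powr e0 + d powr e1) * y ^ k"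
      using y(1) by (intro mult_right_mono growth) auto
    also have "\<dots> = C * (d powr e0 * y ^ k + d powr e1 * y ^ k)" by (simp add: algebra_simps)
    also have "\<dots> \<le> C * (E powr e0 + E powr e1)"
      using assms by (intro mult_left_mono add_mono decay) auto
    finally have "A / R\<^sup>2 * (p * y ^ k) \<le> A / R\<^sup>2 * (C * (E powr e0 + E powr e1))"
      using \<open>0 < A\<close> by (intro mult_left_mono) auto
    then have "p * (A / R\<^sup>2 * w ^ (2 * k)) \<le> A / R\<^sup>2 * C * (E powr e0 + E powr e1)"
      unfolding y_def power_mult[symmetric] by (simp only: mult_ac)
    with main show ?thesis by linarith
  qed
qed

text \<open>The error density times the ball volume is a combination of the powers
  \<open>R^(N - 2 - 2 e)\<close> for the two exponents, both of negative degree.\<close>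

lemma decay_tendsto_0:
  fixes V A C a e0 e1 :: real
  assumes "real N < 2 + 2 * e0" "real N < 2 + 2 * e1" "0 < a"
  shows "((\<lambda>R. A / R\<^sup>2 * C * ((a / R\<^sup>2) powr e0 + (a / R\<^sup>2) powr e1) * (V * R ^ N)) \<longlongrightarrow> 0) at_top"
proof -
  have lim: "((\<lambda>R. a powr e * R powr (real N - 2 - 2 * e)) \<longlongrightarrow> 0) at_top" if "real N < 2 + 2 * e" for e
    using tendsto_mult_right_zero[OF tendsto_neg_powr[OF _ filterlim_ident]] that by simp
  have "((\<lambda>R. A * C * V * (a powr e0 * R powr (real N - 2 - 2 * e0) + a powr e1 * R powr (real N - 2 - 2 * e1)))
      \<longlongrightarrow> 0) at_top"
    using tendsto_add[OF lim[OF assms(1)] lim[OF assms(2)]] by (intro tendsto_mult_right_zero) simp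
  moreover have "\<forall>\<^sub>F R in at_top. A * C * V * (a powr e0 * R powr (real N - 2 - 2 * e0) + a powr e1 * R powr (real N - 2 - 2 * e1))
     = A / R\<^sup>2 * C * ((a / R\<^sup>2) powr e0 + (a / R\<^sup>2) powr e1) * (V * R ^ N)"
    using eventually_gt_at_top[of 0]
  proof eventually_elim
    case (elim R)
    have "a powr e * R powr (real N - 2 - 2 * e) = (a / R\<^sup>2) powr e * R ^ N / R\<^sup>2" for e
    proof -
      have "R\<^sup>2 powr e = R powr (2 * e)" using elim by (simp add: powr_powr flip: powr_numeral)
      then show ?thesis using elim assms(3)
        by (simp add: powr_divide powr_diff powr_realpow)
    qed
    then show ?case by (simp add: algebra_simps add_divide_distrib)
  qed
  ultimately show ?thesis by (rule Lim_transform_eventually)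
qed

text \<open>If \<open>u\<close> is nonzero at \<open>x0\<close>, then \<open>G\<close> exceeds a
  positive constant on a ball around it, so the weighted integral stays above some
  \<open>m > 0\<close> for large R, whereas the energy estimate makes it tend to 0.\<close>

lemma stable_solution_eq_0:
  fixes u :: "real ^ 'n \<Rightarrow> real"
  assumes stable: "stable_solution f u"
    and \<psi>: "\<And>t. (\<psi> has_real_derivative \<psi>' t) (at t)" "continuous_on UNIV \<psi>'"
    and \<phi>: "\<And>t. (\<phi> has_real_derivative (\<psi>' t)\<^sup>2) (at t)"
    and \<Phi>: "\<And>t. (\<Phi> has_real_derivative \<phi> t) (at t)"
    and \<Phi>_bounds: "\<And>t. 0 \<le> \<Phi> t" "\<And>t. \<Phi> t \<le> (\<psi> t)\<^sup>2 / 2"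
    and G_cont: "continuous_on UNIV (\<lambda>t. deriv f t * (\<psi> t)\<^sup>2)"
    and pos: "\<And>t. t \<noteq> 0 \<Longrightarrow> 0 < deriv f t" "\<And>t. t \<noteq> 0 \<Longrightarrow> \<psi> t \<noteq> 0" and "\<psi> 0 = 0"
    and gap: "\<And>t. f t * \<phi> t \<le> (1 - \<kappa>) * (deriv f t * (\<psi> t)\<^sup>2)" "0 < \<kappa>"
    and growth: "0 < C" "\<And>t. t \<noteq> 0 \<Longrightarrow> (\<psi> t)\<^sup>2 \<le> C * (deriv f t powr e0 + deriv f t powr e1)"
    and e: "0 < e0" "0 < e1" "real CARD('n) < 2 + 2 * e0" "real CARD('n) < 2 + 2 * e1"
  shows "u x0 = 0"
proof (rule ccontr)
  assume "u x0 \<noteq> 0"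
  define G where "G x = deriv f (u x) * (\<psi> (u x))\<^sup>2" for x
  define w where "w R x = max 0 (1 - inner x x / R\<^sup>2)" for R and x :: "real ^ 'n"
  obtain k :: nat where k: "e0 \<le> real k" "e1 \<le> real k"
    using real_arch_simple[of "max e0 e1"] by auto
  then have "1 \<le> k" "1 \<le> 2 * k" using e by linarith+
  \<comment> \<open>The sum of the constants in the gradient bound for exponent \<open>k + 1\<close>
    and the Laplacian bound for exponent \<open>2 * k + 2\<close>.\<close>
  define A where "A = 4 * (real (Suc k))\<^sup>2
    + 2 * real (Suc (Suc (2 * k))) * (real CARD('n) + 2 * real (Suc (2 * k)))"
  have "0 < A" unfolding A_def by (intro add_pos_nonneg mult_nonneg_nonneg add_nonneg_nonneg) auto
  define V where "V = unit_ball_vol (real CARD('n))"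
  define D where "D R = A / R\<^sup>2 * C * ((2 * A / \<kappa> / R\<^sup>2) powr e0 + (2 * A / \<kappa> / R\<^sup>2) powr e1)" for R
  have u_cont: "continuous_on UNIV u"
    using stable by (auto simp: stable_solution_def is_solution_def C2_def C1_continuous)
  have G_cont': "continuous_on UNIV G"
    unfolding G_def by (rule continuous_on_compose2[OF G_cont u_cont]) auto
  have G_nonneg: "0 \<le> G x" for x
    using pos(1)[of "u x"] \<open>\<psi> 0 = 0\<close> by (cases "u x = 0") (auto simp: G_def)
  have w_cont: "continuous_on UNIV (w R)" for R unfolding w_def divide_inverse by (intro continuous_intros)
  have energy: "\<kappa> / 2 * (\<integral>x. G x * w R x ^ (2 * k + 2) \<partial>lborel) \<le> D R * (V * R ^ CARD('n))"
    if R: "0 < R" for R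
  proof -
    define \<zeta> where "\<zeta> x = w R x ^ Suc k" for x
    define B where "B = (\<lambda>x. f (u x) * \<phi> (u x) * (\<zeta> x)\<^sup>2 + (\<psi> (u x))\<^sup>2 * (norm (grad \<zeta> x))\<^sup>2
      - ((\<psi> (u x))\<^sup>2 / 2 - \<Phi> (u x)) * laplacian (\<lambda>x. (\<zeta> x)\<^sup>2) x)"
    have \<zeta>2: "(\<zeta> x)\<^sup>2 = w R x ^ Suc (Suc (2 * k))" for x
      by (simp add: \<zeta>_def power2_eq_square mult_2 power_add)
    have C1_\<zeta>: "C1 \<zeta>"
      unfolding \<zeta>_def w_def by (rule C1_cutoff_power[OF R \<open>1 \<le> k\<close>])
    have C2_\<zeta>: "C2 (\<lambda>x. (\<zeta> x)\<^sup>2)"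
      unfolding \<zeta>2 unfolding w_def by (rule C2_cutoff_power[OF R \<open>1 \<le> 2 * k\<close>])
    have w_supp: "w R x = 0" if "R \<le> norm x" for x
      unfolding w_def by (rule cutoff_supp[OF R that])
    have w: "0 \<le> w R x" "w R x \<le> 1" for x by (auto simp: w_def)
    have \<zeta>_supp: "\<zeta> x = 0" if "R < norm x" for x using w_supp that by (simp add: \<zeta>_def)
    have grad_\<zeta>: "(norm (grad \<zeta> x))\<^sup>2 \<le> 4 * (real (Suc k))\<^sup>2 / R\<^sup>2 * w R x ^ (2 * k)" for x
      unfolding \<zeta>_def w_def by (rule cutoff_grad_bound[OF R \<open>1 \<le> k\<close>])
    have lap_\<zeta>: "\<bar>laplacian (\<lambda>x. (\<zeta> x)\<^sup>2) x\<bar> \<le> 2 * real (Suc (Suc (2 * k)))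
        * (real CARD('n) + 2 * real (Suc (2 * k))) / R\<^sup>2 * w R x ^ (2 * k)" for x
      unfolding \<zeta>2 unfolding w_def by (rule cutoff_laplacian_bound[OF R \<open>1 \<le> 2 * k\<close>])
    have stab: "integrable lborel B"
        "(\<integral>x. deriv f (u x) * (\<psi> (u x) * \<zeta> x)\<^sup>2 \<partial>lborel) \<le> (\<integral>x. B x \<partial>lborel)"
      unfolding B_def by (rule stability_inequality[OF stable \<psi> \<phi> \<Phi> C1_\<zeta> C2_\<zeta>], erule \<zeta>_supp)+
    \<comment> \<open>Points with \<open>u x = 0\<close> are treated apart, because positivity and
      growth are only given at nonzero arguments; there \<Phi> vanishes as it lies between 0 and
      \<open>\<psi>\<^sup>2 / 2\<close>. Elsewhere half of the gap \<kappa> pays for the absorbed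
      cutoff terms.\<close>
    have B_le: "B x \<le> (1 - \<kappa> / 2) * (G x * w R x ^ (2 * k + 2)) + D R * indicator (cball 0 R) x" for x
    proof (cases "u x = 0 \<or> R < norm x")
      case True
      then have "B x \<le> 0"
      proof
        assume "u x = 0"
        then have "\<Phi> (u x) = 0" using \<Phi>_bounds[of 0] \<open>\<psi> 0 = 0\<close> by simp
        with \<open>u x = 0\<close> \<open>\<psi> 0 = 0\<close> gap(1)[of 0] show ?thesis by (simp add: B_def mult_nonpos_nonneg)
      next
        assume "R < norm x"
        have "w R x = 0" using w_supp[of x] \<open>R < norm x\<close> by simp
        then have "(norm (grad \<zeta> x))\<^sup>2 \<le> 0" "\<bar>laplacian (\<lambda>x. (\<zeta> x)\<^sup>2) x\<bar> \<le> 0"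
          using grad_\<zeta>[of x] lap_\<zeta>[of x] \<open>1 \<le> k\<close> by (simp_all add: power_0_left)
        with \<zeta>_supp[OF \<open>R < norm x\<close>] show ?thesis by (simp add: B_def)
      qed
      also have "0 \<le> (1 - \<kappa> / 2) * (G x * w R x ^ (2 * k + 2)) + D R * indicator (cball 0 R) x"
      proof (cases "u x = 0")
        case True
        then show ?thesis using \<open>\<psi> 0 = 0\<close> \<open>0 < A\<close> \<open>0 < C\<close> by (simp add: G_def D_def)
      next
        case False
        with True have "w R x = 0" using w_supp[of x] by simp
        then show ?thesis using \<open>0 < A\<close> \<open>0 < C\<close> by (simp add: D_def)
      qed
      finally show ?thesis .
    next
      case False
      let ?p = "(\<psi> (u x))\<^sup>2" and ?d = "deriv f (u x)"
      have "\<bar>(?p / 2 - \<Phi> (u x)) * laplacian (\<lambda>x. (\<zeta> x)\<^sup>2) x\<bar> \<le> ?p * (2 * real (Suc (Suc (2 * k)))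
        * (real CARD('n) + 2 * real (Suc (2 * k))) / R\<^sup>2 * w R x ^ (2 * k))"
        unfolding abs_mult using \<Phi>_bounds[of "u x"] zero_le_power2[of "\<psi> (u x)"]
        by (intro mult_mono lap_\<zeta>) (auto simp: abs_le_iff)
      moreover have "?p * (norm (grad \<zeta> x))\<^sup>2 \<le> ?p * (4 * (real (Suc k))\<^sup>2 / R\<^sup>2 * w R x ^ (2 * k))"
        by (intro mult_left_mono grad_\<zeta>) auto
      moreover have "f (u x) * \<phi> (u x) * (\<zeta> x)\<^sup>2 \<le> (1 - \<kappa>) * (?d * ?p) * (\<zeta> x)\<^sup>2"
        by (intro mult_right_mono gap) auto
      ultimately have "B x \<le> (1 - \<kappa>) * (?d * ?p) * (\<zeta> x)\<^sup>2
          + (?p * (4 * (real (Suc k))\<^sup>2 / R\<^sup>2 * w R x ^ (2 * k)) + ?p * (2 * real (Suc (Suc (2 * k)))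
        * (real CARD('n) + 2 * real (Suc (2 * k))) / R\<^sup>2 * w R x ^ (2 * k)))"
        unfolding B_def by linarith
      also have "?p * (4 * (real (Suc k))\<^sup>2 / R\<^sup>2 * w R x ^ (2 * k)) + ?p * (2 * real (Suc (Suc (2 * k)))
        * (real CARD('n) + 2 * real (Suc (2 * k))) / R\<^sup>2 * w R x ^ (2 * k))
        = ?p * (A / R\<^sup>2 * w R x ^ (2 * k))"
        unfolding A_def add_divide_distrib distrib_right distrib_left by (simp only: distrib_left)
      also have "\<dots> \<le> \<kappa> / 2 * (?d * ?p) * w R x ^ (2 * k + 2) + D R"
        unfolding D_def using False \<open>0 < A\<close> e k w R gap(2) growth pos
        by (intro absorb_or_decay) auto
      finally have "B x \<le> (1 - \<kappa>) * (?d * ?p) * (\<zeta> x)\<^sup>2 + (\<kappa> / 2 * (?d * ?p) * w R x ^ (2 * k + 2) + D R)"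
        by simp
      then show ?thesis using False by (simp add: G_def \<zeta>2 algebra_simps)
    qed
    have "continuous_on UNIV (\<lambda>x. G x * w R x ^ (2 * k + 2))"
      by (intro continuous_intros G_cont' w_cont)
    then have int_G: "integrable lborel (\<lambda>x. G x * w R x ^ (2 * k + 2))"
      by (rule integrable_compactly_supported[of _ R]) (use w_supp in simp)
    have int_D: "integrable lborel (\<lambda>x :: real ^ 'n. D R * indicator (cball 0 R) x)"
      by (intro integrable_mult_right integrable_real_indicator) (use emeasure_lborel_cball_finite in auto)
    \<comment> \<open>The integral is bounded by \<open>1 - \<kappa> / 2\<close> times itself plus
      the error; being finite, it can be moved to the left, where \<open>\<kappa> / 2\<close> of it
      remains.\<close>
    have "(\<integral>x. G x * w R x ^ (2 * k + 2) \<partial>lborel) = (\<integral>x. deriv f (u x) * (\<psi> (u x) * \<zeta> x)\<^sup>2 \<partial>lborel)"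
      by (simp add: G_def power_mult_distrib \<zeta>2 mult.assoc del: power_Suc)
    also have "\<dots> \<le> (\<integral>x. B x \<partial>lborel)" by (rule stab(2))
    also have "\<dots> \<le> (\<integral>x. (1 - \<kappa> / 2) * (G x * w R x ^ (2 * k + 2)) + D R * indicator (cball 0 R) x \<partial>lborel)"
      by (intro integral_mono B_le Bochner_Integration.integrable_add integrable_mult_right[OF int_G] int_D stab(1))
    also have "\<dots> = (1 - \<kappa> / 2) * (\<integral>x. G x * w R x ^ (2 * k + 2) \<partial>lborel)
        + D R * measure lborel (cball 0 R :: (real ^ 'n) set)"
      using int_G int_D by simp
    also have "measure lborel (cball 0 R :: (real ^ 'n) set) = V * R ^ CARD('n)"
      using content_cball[of R "0 :: real ^ 'n"] R by (simp add: V_def)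
    finally show ?thesis by (simp add: algebra_simps)
  qed
  have "((\<lambda>R. D R * (V * R ^ CARD('n))) \<longlongrightarrow> 0) at_top"
    unfolding D_def using decay_tendsto_0[OF e(3,4), of "2 * A / \<kappa>"] \<open>0 < A\<close> gap(2) by simp
  moreover
  define c where "c = G x0 / 2"
  have c: "0 < c" using pos[OF \<open>u x0 \<noteq> 0\<close>] by (simp add: c_def G_def)
  have "open {x. c < G x}" by (intro open_Collect_less continuous_intros G_cont')
  then obtain \<delta> where \<delta>: "0 < \<delta>" "ball x0 \<delta> \<subseteq> {x. c < G x}"
    using c unfolding open_contains_ball c_def by force
  define m where "m = \<kappa> / 2 * (c * (1 / 2) ^ (2 * k + 2) * measure lborel (ball x0 \<delta>))"
  have "0 < measure lborel (ball x0 \<delta>)"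
    using content_ball_pos \<delta>(1) by simp
  then have "0 < m" using c gap(2) by (simp add: m_def)
  \<comment> \<open>For \<open>R \<ge> R0\<close> every point of the ball has norm at most
    \<open>R / 2\<close>, which keeps the cutoff base at least 1/2 there.\<close>
  define R0 where "R0 = 2 * (norm x0 + \<delta>)"
  have "m \<le> D R * (V * R ^ CARD('n))" if R: "R0 \<le> R" for R
  proof -
    have "0 < R0" using \<delta>(1) by (simp add: R0_def add_nonneg_pos)
    then have "0 < R" using R by simp
    have lower: "c * (1 / 2) ^ (2 * k + 2) * indicator (ball x0 \<delta>) x \<le> G x * w R x ^ (2 * k + 2)" for x
    proof (cases "x \<in> ball x0 \<delta>")
      case True
      have "norm x \<le> norm x0 + dist x0 x"
        by (metis add.commute dist_norm norm_triangle_sub norm_minus_commute)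
      with True R have "2 * norm x \<le> R" by (simp add: R0_def)
      then have "(2 * norm x)\<^sup>2 \<le> R\<^sup>2" by (intro power_mono) auto
      then have "4 * inner x x \<le> R\<^sup>2" by (simp add: power_mult_distrib power2_norm_eq_inner)
      then have "2 * inner x x \<le> R\<^sup>2" using inner_ge_zero[of x] by linarith
      then have "inner x x / R\<^sup>2 \<le> 1 / 2" using \<open>0 < R\<close> by (simp add: field_simps)
      then have "1 / 2 \<le> 1 - inner x x / R\<^sup>2" by simp
      then have "1 / 2 \<le> w R x" unfolding w_def by (rule max.coboundedI2)
      then have "c * (1 / 2) ^ (2 * k + 2) \<le> G x * w R x ^ (2 * k + 2)"
        using True \<delta>(2) c by (intro mult_mono power_mono) auto
      with True show ?thesis by simp
    next
      case False
      then show ?thesis using G_nonneg[of x] by (simp add: w_def)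
    qed
    have "continuous_on UNIV (\<lambda>x. G x * w R x ^ (2 * k + 2))"
      by (intro continuous_intros G_cont' w_cont)
    then have int_G: "integrable lborel (\<lambda>x. G x * w R x ^ (2 * k + 2))"
    proof (rule integrable_compactly_supported)
      show "G x * w R x ^ (2 * k + 2) = 0" if "R < norm x" for x
        using cutoff_supp[OF \<open>0 < R\<close>, of x] that by (simp add: w_def)
    qed
    have int_1: "integrable lborel (\<lambda>x. c * (1 / 2) ^ (2 * k + 2) * indicator (ball x0 \<delta>) x :: real)"
      by (intro integrable_mult_right integrable_real_indicator) (use emeasure_lborel_ball_finite in auto)
    have "c * (1 / 2) ^ (2 * k + 2) * measure lborel (ball x0 \<delta>)
      = (\<integral>x. c * (1 / 2) ^ (2 * k + 2) * indicator (ball x0 \<delta>) x \<partial>lborel)" by simp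
    also have "\<dots> \<le> (\<integral>x. G x * w R x ^ (2 * k + 2) \<partial>lborel)"
      by (rule integral_mono[OF int_1 int_G lower])
    finally have "m \<le> \<kappa> / 2 * (\<integral>x. G x * w R x ^ (2 * k + 2) \<partial>lborel)"
      unfolding m_def using gap(2) by (intro mult_left_mono) auto
    also have "\<dots> \<le> D R * (V * R ^ CARD('n))" by (rule energy[OF \<open>0 < R\<close>])
    finally show ?thesis .
  qed
  then have "\<forall>\<^sub>F R in at_top. m \<le> D R * (V * R ^ CARD('n))"
    unfolding eventually_at_top_linorder by blast
  ultimately have "m \<le> 0"
    by (intro tendsto_lowerbound[of _ 0 at_top]) auto
  with \<open>0 < m\<close> show False by simp
qed

theorem corollary1p10:
  fixes f :: "real \<Rightarrow> real" and u :: "real ^ 'n \<Rightarrow> real"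
    and q0 qinf p0 pinf :: ereal
  assumes "continuous_on UNIV f" and "C2_pos f"
    and "mono f" and "\<And>t. f (- t) = - f t"
    and "convex_on {0<..} f" and "\<And>t. t > 0 \<Longrightarrow> f t > 0"
    and "(q_fun f \<longlongrightarrow> q0) (at_right 0)" and "p0 = conj_exponent q0"
    and "qinf = Limsup at_top (q_fun f)" and "pinf = conj_exponent qinf"
    and "stable_solution f u"
    and "(1 \<le> CARD('n) \<and> CARD('n) \<le> 9 \<and> 1 < p0 \<and> 1 < pinf)
       \<or> (CARD('n) = 10 \<and> 1 < p0 \<and> p0 < \<infinity> \<and> 1 < pinf \<and> pinf < \<infinity>)
       \<or> (11 \<le> CARD('n) \<and> 1 < p0 \<and> p0 < ereal (p_c CARD('n))
            \<and> 1 < pinf \<and> pinf < ereal (p_c CARD('n)))"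
  shows "\<forall>x. u x = 0"
proof -
  have f_odd: "f (- t) = - f t" and f_pos: "t > 0 \<Longrightarrow> f t > 0" for t by fact+
  have df: "(f has_real_derivative deriv f t) (at t)"
    and ddf: "(deriv f has_real_derivative deriv (deriv f) t) (at t)" if "0 < t" for t
    using assms(2) that DERIV_deriv_iff_real_differentiable unfolding C2_pos_def by blast+
  have f'_mono: "deriv f s \<le> deriv f t" if "0 < s" "s \<le> t" for s t
    using convex_deriv_mono[OF assms(5) df that] .
  have f''_nonneg: "0 \<le> deriv (deriv f) t" if "0 < t" for t
    using nonneg_deriv_of_mono[OF ddf[OF that] that f'_mono] .
  have f_cont: "isCont f t" for t using assms(1) by (simp add: continuous_on_eq_continuous_at)
  have "f 0 = 0" using f_odd[of 0] by simp
  have f_at_0: "(f \<longlongrightarrow> 0) (at_right 0)"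
    using f_cont[of 0] \<open>f 0 = 0\<close> by (auto simp: isCont_def filterlim_at_split)
  \<comment> \<open>The mean value theorem from \<open>f 0 = 0\<close> gives a positive slope at
    some point before \<open>t\<close>, and the derivative is nondecreasing.\<close>
  have f'_pos: "0 < deriv f t" if t: "0 < t" for t
  proof -
    have "continuous_on {0..t} f" using f_cont by (simp add: continuous_at_imp_continuous_on)
    with t obtain z where z: "0 < z" "z < t" "f t - f 0 = deriv f z * (t - 0)"
      by (rule mvt[where f' = "\<lambda>z. (*) (deriv f z)"]) (use df in \<open>auto simp: has_field_derivative_def\<close>)
    then have "0 < deriv f z" using f_pos[OF t] t \<open>f 0 = 0\<close> by (simp add: zero_less_mult_iff)
    with f'_mono[of z t] z show ?thesis by simp
  qed
  interpret convex_nonlinearity f "deriv f" "deriv (deriv f)"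
    by unfold_locales (use df ddf f_pos f'_pos f''_nonneg f_at_0 in auto)
  have "1 < conj_exponent q0" "1 < conj_exponent qinf" using assms(8,10,12) by auto
  then obtain q Q where q: "q0 = ereal q" "1 \<le> q" and Q: "qinf = ereal Q" "1 \<le> Q"
    by (metis conj_exponent_gt_1D)
  have "real CARD('n) < 4 * q + 4 * sqrt q + 2"
    using assms(8,10,12) q by (intro subcritical_dimension) auto
  then obtain b0 \<nu> \<theta> where par: "0 < b0" "b0\<^sup>2 < \<nu>" "\<nu> < 1 / q" "1 / q < \<theta>"
      "real CARD('n) < 2 + 4 * (1 + b0) / \<theta>"
    using weight_parameters_exist[OF q(2)] by blast
  have "0 < 1 / q" "1 / q \<le> 1" using q(2) by auto
  then have \<theta>: "0 < \<theta>" and \<nu>: "0 < \<nu>" "\<nu> \<le> 1"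
    using par zero_le_power2[of b0] by linarith+
  \<comment> \<open>\<open>S > Q\<close> bounds \<open>q_fun\<close> near infinity, and
    \<open>S \<ge> N\<close> makes the second exponent \<open>4 / \<mu> = 4 * S\<close> satisfy the
    dimension condition.\<close>
  define S where "S = max (Q + 1) (real CARD('n))"
  define \<mu> where "\<mu> = 1 / S"
  have S: "Q < S" "1 < S" "real CARD('n) \<le> S" using Q(2) by (auto simp: S_def)
  have \<mu>: "0 < \<mu>" "\<mu> \<le> 1" using S by (auto simp: \<mu>_def)
  have lim: "(q_fun f \<longlongrightarrow> ereal q) (at_right 0)" using assms(7) q(1) by simp
  have "ereal q < ereal (1 / \<nu>)" "ereal (1 / \<theta>) < ereal q"
    using par \<theta> \<nu> q(2) by (auto simp: field_simps)
  then have "\<forall>\<^sub>F t in at_right 0. q_fun f t < ereal (1 / \<nu>) \<and> ereal (1 / \<theta>) < q_fun f t"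
    by (intro eventually_conj order_tendstoD[OF lim])
  then obtain T where T: "0 < T"
    "\<And>t. 0 < t \<Longrightarrow> t < T \<Longrightarrow> q_fun f t < ereal (1 / \<nu>) \<and> ereal (1 / \<theta>) < q_fun f t"
    by (auto simp: eventually_at_right_field)
  have "\<forall>\<^sub>F t in at_top. q_fun f t < ereal S"
    using S(1) Q(1) assms(9) by (intro Limsup_lessD) simp
  then obtain T' where T': "\<And>t. T' \<le> t \<Longrightarrow> q_fun f t < ereal S"
    by (auto simp: eventually_at_top_linorder)
  \<comment> \<open>The bounds hold for t < T, whereas the weight needs them up to and including
    \<open>t0\<close>.\<close>
  define t0 where "t0 = T / 2"
  define t1 where "t1 = max t0 T'"
  have t01: "0 < t0" "t0 \<le> t1" using T(1) by (auto simp: t0_def t1_def)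
  have near_0: "\<nu> * (deriv f t)\<^sup>2 \<le> f t * deriv (deriv f) t" "f t * deriv (deriv f) t \<le> \<theta> * (deriv f t)\<^sup>2"
    if "0 < t" "t \<le> t0" for t
    using q_fun_lessD[of f t "1 / \<nu>"] q_fun_greaterD[of "1 / \<theta>" f t] T(2)[of t] that T(1) \<nu> \<theta>
      f_pos[of t] f''_nonneg[of t] by (auto simp: t0_def)
  have large: "\<mu> * (deriv f t)\<^sup>2 \<le> f t * deriv (deriv f) t" if "t1 \<le> t" for t
    using q_fun_lessD[of f t S] T'[of t] that S(2) t01 f_pos[of t] f''_nonneg[of t]
    by (auto simp: t1_def \<mu>_def)
  \<comment> \<open>The slope at infinity is taken to be \<open>\<mu> / 2\<close>; its square is
    below \<mu> because \<mu> is at most 1.\<close>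
  have b1: "0 \<le> \<mu> / 2" "(\<mu> / 2)\<^sup>2 < \<mu>"
    using \<mu> mult_left_mono[of \<mu> 1 \<mu>] by (auto simp: power2_eq_square)
  obtain \<psi> \<psi>' \<phi> \<Phi> :: "real \<Rightarrow> real" and \<kappa> C :: real where
    \<psi>: "\<And>t. (\<psi> has_real_derivative \<psi>' t) (at t)" "continuous_on UNIV \<psi>'"
    and \<phi>: "\<And>t. (\<phi> has_real_derivative (\<psi>' t)\<^sup>2) (at t)"
    and \<Phi>: "\<And>t. (\<Phi> has_real_derivative \<phi> t) (at t)"
    and \<psi>_even: "\<And>t. \<psi> (- t) = \<psi> t" and \<phi>_odd: "\<And>t. \<phi> (- t) = - \<phi> t" and \<psi>_0: "\<psi> 0 = 0"
    and \<psi>_pos: "\<And>t. 0 < t \<Longrightarrow> 0 < \<psi> t"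
    and \<Phi>_bounds: "\<And>t. 0 \<le> \<Phi> t" "\<And>t. \<Phi> t \<le> (\<psi> t)\<^sup>2 / 2"
    and \<kappa>: "0 < \<kappa>" and gap: "\<And>t. 0 < t \<Longrightarrow> f t * \<phi> t \<le> (1 - \<kappa>) * (deriv f t * (\<psi> t)\<^sup>2)"
    and C: "0 < C"
    and growth: "\<And>t. 0 < t \<Longrightarrow> (\<psi> t)\<^sup>2 \<le> C * (deriv f t powr (2 * (1 + b0) / \<theta>) + deriv f t powr (4 / \<mu>))"
    and lim_0: "((\<lambda>t. deriv f t * (\<psi> t)\<^sup>2) \<longlongrightarrow> 0) (at_right 0)"
    using even_weight_exists[OF t01 par(1,2) \<nu>(2) b1 \<mu>(2) near_0 large] by blast
  have f'_even: "deriv f (- t) = deriv f t" if "0 < t" for t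
  proof -
    have "((\<lambda>s. - f (- s)) has_real_derivative deriv f t) (at (- t))"
      using DERIV_minus[OF DERIV_chain2[OF _ DERIV_minus[OF DERIV_ident], of f _ "- t"]] df[OF that] by simp
    moreover have "(\<lambda>s. - f (- s)) = f" by (simp add: f_odd)
    ultimately show ?thesis by (simp add: DERIV_imp_deriv)
  qed
  define G where "G t = deriv f t * (\<psi> t)\<^sup>2" for t
  have G_even: "G t = G \<bar>t\<bar>" for t
    using f'_even[of "- t"] \<psi>_even[of "- t"] by (cases "0 \<le> t") (auto simp: G_def)
  \<comment> \<open>At 0 the value is 0 because \<open>\<psi> 0 = 0\<close>, and by evenness it
    matches the one-sided limit; elsewhere continuity is carried over from the positive
    half-line.\<close>
  have "isCont G t" for t
  proof (cases "t = 0")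
    case True
    have "((\<lambda>t. G \<bar>t\<bar>) \<longlongrightarrow> 0) (at 0)"
      using tendsto_even_at_0[OF lim_0] by (simp add: G_def)
    also have "(\<lambda>t. G \<bar>t\<bar>) = G" by (rule ext) (rule G_even[symmetric])
    finally show ?thesis using True \<psi>_0 by (simp add: isCont_def G_def[of 0])
  next
    case False
    have "isCont (\<lambda>s. deriv f s * (\<psi> s)\<^sup>2) \<bar>t\<bar>"
      using False DERIV_isCont[OF ddf[of "\<bar>t\<bar>"]] DERIV_isCont[OF \<psi>(1)] by (intro continuous_intros) auto
    then have "isCont (\<lambda>s. G \<bar>s\<bar>) t"
      unfolding G_def by (rule isCont_o2[OF isCont_rabs[OF continuous_ident]])
    then show ?thesis by (simp flip: G_even)
  qed
  then have G_cont: "continuous_on UNIV (\<lambda>t. deriv f t * (\<psi> t)\<^sup>2)"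
    unfolding G_def by (simp add: continuous_at_imp_continuous_on)
  \<comment> \<open>Since \<psi> and the derivative of \<open>f\<close> are even and
    \<open>f\<close> and \<phi> are odd, every remaining condition is invariant under
    reflection.\<close>
  have reduce: "P t" if "t \<noteq> 0" "\<And>t. 0 < t \<Longrightarrow> P t" "\<And>t. 0 < t \<Longrightarrow> P t \<Longrightarrow> P (- t)" for P and t :: real
    using that by (metis minus_minus neg_0_less_iff_less linorder_neqE_linordered_idom)
  show ?thesis
  proof (intro allI stable_solution_eq_0[OF assms(11) \<psi> \<phi> \<Phi> \<Phi>_bounds G_cont _ _ \<psi>_0 _ \<kappa> C])
    show "0 < deriv f t" if "t \<noteq> 0" for t
      using that by (rule reduce) (simp_all add: f'_pos f'_even)
    show "\<psi> t \<noteq> 0" if "t \<noteq> 0" for t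
      using that by (rule reduce) (simp_all add: \<psi>_pos \<psi>_even less_imp_neq[symmetric])
    show "f t * \<phi> t \<le> (1 - \<kappa>) * (deriv f t * (\<psi> t)\<^sup>2)" for t
    proof (cases "t = 0")
      case False
      then show ?thesis
        by (rule reduce) (simp_all add: gap f_odd \<phi>_odd \<psi>_even f'_even)
    qed (simp add: \<open>f 0 = 0\<close> \<psi>_0)
    show "(\<psi> t)\<^sup>2 \<le> C * (deriv f t powr (2 * (1 + b0) / \<theta>) + deriv f t powr (4 / \<mu>))" if "t \<noteq> 0" for t
      using that by (rule reduce) (rule growth, simp_all add: \<psi>_even f'_even)
    show "0 < 2 * (1 + b0) / \<theta>" "0 < 4 / \<mu>" using par(1) \<theta> \<mu> by auto
    show "real CARD('n) < 2 + 2 * (2 * (1 + b0) / \<theta>)" using par(5) by simp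
    show "real CARD('n) < 2 + 2 * (4 / \<mu>)" using S by (simp add: \<mu>_def)
  qed
qed

end
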